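(* Let $f_1,\dots,f_m$ be polynomials in $z=(z_1,\dots,z_n)$ with complex coefficients, each of which is completely nonvanishing on the positive orthant $\mathbb{R}^n_+=(0,\infty)^n$. Then the Euler--Mellin integral $$M_f(s,t)=\int_{\mathbb{R}_+^n}\frac{z^s}{f(z)^t}\,\frac{dz_1\wedge\cdots\wedge dz_n}{z_1\cdots z_n}=\int_{\mathbb{R}^n}\frac{e^{\langle s,x\rangle}}{f(e^x)^t}\,dx_1\wedge\cdots\wedge dx_n$$ converges and defines an analytic function in the tube domain $$\bigl\{(s,t)\in\mathbb{C}^{n+m}\ \bigm|\ \tau:=\operatorname{Re} t\in\mathbb{R}_+^m,\ \ \sigma:=\operatorname{Re} s\in\operatorname{int}(\tau\Delta_f)\bigr\}.$$
   Context: Notation: $\mathbb{R}_+=(0,\infty)$. For $s\in\mathbb{C}^n$ and $t\in\mathbb{C}^m$, $z^s:=z_1^{s_1}\cdots z_n^{s_n}$ and $f(z)^t:=f_1(z)^{t_1}\cdots f_m(z)^{t_m}$; also $e^x=(e^{x_1},\dots,e^{x_n})$, $\langle s,x\rangle=\sum_j s_jx_j$. On $\mathbb{R}^n_+$ one uses $z^s=e^{\langle s,\log z\rangle}$ with real logarithms, and $f_i^{t_i}=\exp(t_i\log f_i)$ for a fixed continuous branch of $\log f_i$ on the simply connected set $\mathbb{R}^n_+$, where $f_i$ has no zeros. For a polynomial $g=\sum_{\alpha\in\operatorname{supp}(g)}c_\alpha z^\alpha$ (all $c_\alpha\neq 0$), $\Delta_g\subset\mathbb{R}^n$ is its Newton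 polytope, the convex hull of $\operatorname{supp}(g)$. For a face $\Gamma$ of $\Delta_g$ (including $\Delta_g$ itself), the truncated polynomial is $g_\Gamma:=\sum_{\alpha\in\Gamma\cap\operatorname{supp}(g)}c_\alpha z^\alpha$. The polynomial $g$ is completely nonvanishing on a set $X$ if for each face $\Gamma$ of $\Delta_g$ the polynomial $g_\Gamma$ has no zeros on $X$. For $\tau\in\mathbb{R}^m_+$, $\tau\Delta_f:=\sum_{i=1}^m\tau_i\Delta_{f_i}$ is the weighted Minkowski sum, and $\operatorname{int}$ denotes the interior in $\mathbb{R}^n$. *)

theory Defs
  imports "HOL-Analysis.Analysis" "HOL-Library.Poly_Mapping"
begin

text \<open>
  Throughout, finite index types \<^typ>\<open>'n\<close> and \<^typ>\<open>'m\<close> play the role of the index sets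
  of the variables and of the polynomials.  A polynomial is a finitely supported family of
  coefficients indexed by exponent vectors, so its support is \<open>Poly_Mapping.keys\<close>.
\<close>

type_synonym 'n cmpoly = "(nat ^ 'n) \<Rightarrow>\<^sub>0 complex"

definition peval :: "'n::finite cmpoly \<Rightarrow> complex ^ 'n \<Rightarrow> complex" where
  "peval g z = (\<Sum>\<alpha>\<in>Poly_Mapping.keys g. Poly_Mapping.lookup g \<alpha> * (\<Prod>j\<in>UNIV. z $ j ^ (\<alpha> $ j)))"

definition real_exponent :: "nat ^ 'n \<Rightarrow> real ^ 'n" where
  "real_exponent \<alpha> = (\<chi> j. real (\<alpha> $ j))"

definition newton_polytope :: "'n::finite cmpoly \<Rightarrow> (real ^ 'n) set" where
  "newton_polytope g = convex hull (real_exponent ` Poly_Mapping.keys g)"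

definition truncation :: "'n::finite cmpoly \<Rightarrow> (real ^ 'n) set \<Rightarrow> 'n cmpoly" where
  "truncation g \<Gamma> =
     (\<Sum>\<alpha> | \<alpha> \<in> Poly_Mapping.keys g \<and> real_exponent \<alpha> \<in> \<Gamma>.
        Poly_Mapping.single \<alpha> (Poly_Mapping.lookup g \<alpha>))"

text \<open>
  The library relation \<open>face_of\<close> counts the empty set as a face.  Its truncation is zero, so the
  empty face has to be left out, except when it is the whole Newton polytope, that is for
  \<open>g = 0\<close>; the zero polynomial is thus not completely nonvanishing on any nonempty set.
\<close>

definition completely_nonvanishing :: "'n::finite cmpoly \<Rightarrow> (complex ^ 'n) set \<Rightarrow> bool" where
  "completely_nonvanishing g X \<longleftrightarrow>
     (\<forall>\<Gamma>. \<Gamma> face_of newton_polytope g \<and> (\<Gamma> \<noteq> {} \<or> \<Gamma> = newton_polytope g) \<longrightarrow>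
        (\<forall>z\<in>X. peval (truncation g \<Gamma>) z \<noteq> 0))"

definition pos_orthant :: "(real ^ 'n) set" where
  "pos_orthant = {z. \<forall>j. 0 < z $ j}"

definition cvec :: "real ^ 'n \<Rightarrow> complex ^ 'n" where
  "cvec z = (\<chi> j. of_real (z $ j))"

definition log_branch :: "'n::finite cmpoly \<Rightarrow> (real ^ 'n \<Rightarrow> complex) \<Rightarrow> bool" where
  "log_branch g l \<longleftrightarrow>
     continuous_on pos_orthant l \<and> (\<forall>z\<in>pos_orthant. exp (l z) = peval g (cvec z))"

lemma log_branch_exists:
  fixes g :: "'n::finite cmpoly"
  assumes "\<And>z. z \<in> pos_orthant \<Longrightarrow> peval g (cvec z) \<noteq> 0"
  shows "\<exists>l. log_branch g l"
proof -
  have "convex (pos_orthant :: (real ^ 'n) set)"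
    unfolding pos_orthant_def convex_alt
    by (auto simp: add_nonneg_pos add_pos_nonneg le_less)
  then have "contractible (pos_orthant :: (real ^ 'n) set)"
    by (rule convex_imp_contractible)
  moreover have "continuous_on pos_orthant (\<lambda>z :: real ^ 'n. peval g (cvec z))"
    unfolding peval_def cvec_def by (simp, intro continuous_intros)
  ultimately show ?thesis
    using continuous_logarithm_on_contractible[of pos_orthant "\<lambda>z. peval g (cvec z)"] assms
    unfolding log_branch_def by metis
qed

text \<open>On positive reals, \<open>powr\<close> with a complex exponent uses the real logarithm.\<close>

definition monomial_power :: "real ^ 'n::finite \<Rightarrow> complex ^ 'n \<Rightarrow> complex" where
  "monomial_power z s = (\<Prod>j\<in>UNIV. complex_of_real (z $ j) powr (s $ j))"

text \<open>\<open>f(z)^t\<close>, where \<open>L i\<close> is the chosen branch of \<open>log f\<^sub>i\<close> on the positive orthant.\<close>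

definition branch_power ::
    "('m::finite \<Rightarrow> real ^ 'n \<Rightarrow> complex) \<Rightarrow> real ^ 'n \<Rightarrow> complex ^ 'm \<Rightarrow> complex" where
  "branch_power L z t = (\<Prod>i\<in>UNIV. exp (t $ i * L i z))"

definition exp_vec :: "real ^ 'n \<Rightarrow> real ^ 'n" where
  "exp_vec x = (\<chi> j. exp (x $ j))"

definition euler_mellin_integrand ::
    "('m::finite \<Rightarrow> real ^ 'n::finite \<Rightarrow> complex) \<Rightarrow> complex ^ 'n \<Rightarrow> complex ^ 'm \<Rightarrow> real ^ 'n \<Rightarrow> complex"
  where
  "euler_mellin_integrand L s t z =
     monomial_power z s / branch_power L z t / complex_of_real (\<Prod>j\<in>UNIV. z $ j)"

definition euler_mellin_exp_integrand ::
    "('m::finite \<Rightarrow> real ^ 'n::finite \<Rightarrow> complex) \<Rightarrow> complex ^ 'n \<Rightarrow> complex ^ 'm \<Rightarrow> real ^ 'n \<Rightarrow> complex"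
  where
  "euler_mellin_exp_integrand L s t x =
     exp (\<Sum>j\<in>UNIV. s $ j * complex_of_real (x $ j)) / branch_power L (exp_vec x) t"

definition euler_mellin ::
    "('m::finite \<Rightarrow> real ^ 'n::finite \<Rightarrow> complex) \<Rightarrow> complex ^ 'n \<Rightarrow> complex ^ 'm \<Rightarrow> complex" where
  "euler_mellin L s t = (LINT z:pos_orthant|lborel. euler_mellin_integrand L s t z)"

text \<open>The sum of sets below is the Minkowski sum.\<close>

definition weighted_newton_polytope ::
    "('m::finite \<Rightarrow> 'n::finite cmpoly) \<Rightarrow> real ^ 'm \<Rightarrow> (real ^ 'n) set" where
  "weighted_newton_polytope f \<tau> = (\<Sum>i\<in>UNIV. (\<lambda>p. \<tau> $ i *\<^sub>R p) ` newton_polytope (f i))"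

text \<open>A point of \<open>\<complex>\<^bsup>n+m\<^esup>\<close> is a vector indexed by the sum type; these are its two blocks.\<close>

definition s_part :: "complex ^ ('n::finite + 'm::finite) \<Rightarrow> complex ^ 'n" where
  "s_part w = (\<chi> j. w $ Inl j)"

definition t_part :: "complex ^ ('n::finite + 'm::finite) \<Rightarrow> complex ^ 'm" where
  "t_part w = (\<chi> i. w $ Inr i)"

definition re_vec :: "complex ^ 'k \<Rightarrow> real ^ 'k" where
  "re_vec w = (\<chi> j. Re (w $ j))"

definition tube_domain ::
    "('m::finite \<Rightarrow> 'n::finite cmpoly) \<Rightarrow> (complex ^ ('n + 'm)) set" where
  "tube_domain f =
     {w. re_vec (t_part w) \<in> pos_orthant \<and>
         re_vec (s_part w) \<in> interior (weighted_newton_polytope f (re_vec (t_part w)))}"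

text \<open>
  Analyticity in several complex variables: near each point of \<open>U\<close>, the function is the sum of an
  (unconditionally convergent) power series on a polydisc around that point.
\<close>

definition mv_analytic_on :: "(complex ^ 'k::finite \<Rightarrow> complex) \<Rightarrow> (complex ^ 'k) set \<Rightarrow> bool" where
  "mv_analytic_on F U \<longleftrightarrow>
     (\<forall>a\<in>U. \<exists>r>0. \<exists>c :: nat ^ 'k \<Rightarrow> complex.
        \<forall>w. (\<forall>j. norm (w $ j - a $ j) < r) \<longrightarrow>
          ((\<lambda>\<alpha>. c \<alpha> * (\<Prod>j\<in>UNIV. (w $ j - a $ j) ^ (\<alpha> $ j))) has_sum F w) UNIV)"

end

theory Submission
  imports Defs
begin

text \<open>
  After the substitution \<open>z = e\<^sup>x\<close> the integrand is \<open>exp (\<Sum>k. w\<^sub>k * \<l>\<^sub>k x)\<close> with \<open>w = (s, t)\<close>, where the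
  functions \<open>\<l>\<^sub>k\<close> are the coordinates \<open>x\<^sub>j\<close> and the negative logarithms \<open>- log f\<^sub>i (e\<^sup>x)\<close>. So the
  Euler-Mellin integral is a Laplace transform, and both convergence and analyticity follow from
  two estimates: the \<open>\<l>\<^sub>k\<close> grow at most linearly, and on the tube domain the absolute value of the
  integrand is at most \<open>exp (C - \<epsilon> * norm x)\<close>. Under these estimates the Taylor series of the
  exponential around a point of the tube may be integrated term by term
  (\<open>laplace_transform_power_series\<close>), which yields the power series directly.

  The decay (\<open>exponential_decay\<close>) has two sources. The first is that a completely nonvanishing \<open>g\<close> is
  comparable from below with its largest monomial: \<open>c * exp (p \<bullet> x) \<le> \<bar>g (e\<^sup>x)\<bar>\<close> for all \<open>x\<close> and all
  points \<open>p\<close> of the Newton polytope (\<open>completely_nonvanishing_lower_bound\<close> for the exponents,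
  \<open>Re_log_branch_lower_bound\<close> for all its points). Along a sequence that
  violates this, only the monomials on one face would survive in the limit, and the truncation to
  that face would have a zero on the positive orthant. Being interior, \<open>Re s\<close> can be moved a little
  in the direction of \<open>x\<close> within the weighted polytope, and this gives the decay in \<open>norm x\<close>.

  The second source concerns \<open>\<bar>f\<^sub>i\<^sup>t\<bar>\<close> for nonreal exponents, which involves the argument of \<open>f\<^sub>i\<close>.
  The argument of \<open>f\<^sub>i (e\<^sup>x)\<close> is bounded on the whole space (\<open>log_branch_bounded_argument\<close>): on the
  segment from \<open>0\<close> to \<open>x\<close> the real part of \<open>f\<^sub>i\<close> is a real exponential sum, whose number of zeros is
  bounded by its number of terms, and the argument cannot vary by more than \<open>pi\<close> between zeros of
  the real part.
\<close>

section \<open>The argument of an exponential sum\<close>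

text \<open>
  Between consecutive zeros lies a zero of the derivative. The bound by \<open>Max Z\<close> only serves the
  induction: it keeps the zero found in the last gap different from the earlier ones.
\<close>

lemma Rolle_finite_zeros:
  fixes g :: "real \<Rightarrow> real"
  assumes "finite Z" "Z \<noteq> {}"
    and "\<And>u. (g has_real_derivative g' u) (at u)"
    and "\<And>u. u \<in> Z \<Longrightarrow> g u = 0"
  shows "\<exists>Y. finite Y \<and> card Z = Suc (card Y) \<and> (\<forall>u\<in>Y. u < Max Z \<and> g' u = 0)"
  using assms(1,2,4)
proof (induction Z rule: finite_linorder_max_induct)
  case empty
  then show ?case by simp
next
  case (insert b A)
  show ?case
  proof (cases "A = {}")
    case True
    then show ?thesis by (intro exI[of _ "{}"]) auto
  next
    case False
    with insert obtain Y where Y: "finite Y" "card A = Suc (card Y)" "\<And>u. u \<in> Y \<Longrightarrow> u < Max A \<and> g' u = 0"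
      by auto
    have "Max A \<in> A" using False insert.hyps by auto
    then have "Max A < b" "g (Max A) = g b" using insert by auto
    moreover have "continuous_on {Max A..b} g"
      using assms(3) by (meson DERIV_isCont continuous_at_imp_continuous_on)
    ultimately obtain z where z: "Max A < z" "z < b" "(g has_real_derivative 0) (at z)"
      using Rolle[of "Max A" b g] assms(3) real_differentiable_def by blast
    then have "g' z = 0" using assms(3) DERIV_unique by blast
    moreover have "z \<notin> Y" using Y(3) z(1) by fastforce
    moreover have "Max (insert b A) = b" using insert.hyps by (intro Max_eqI) (auto simp: less_imp_le)
    moreover have "b \<notin> A" using insert.hyps by auto
    ultimately show ?thesis
      using Y z insert.hyps by (intro exI[of _ "insert z Y"]) fastforce
  qed
qed

text \<open>
  After division by \<open>exp (\<mu> k * u)\<close> the term with index \<open>k\<close> is constant, so the derivative is an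
  exponential sum with one term less, and by Rolle's theorem it loses at most one zero. The
  exponents may coincide; this is why the conclusion is that the sum vanishes identically, and not
  that its coefficients do.
\<close>

lemma exponential_sum_zeros:
  fixes a \<mu> :: "'i \<Rightarrow> real"
  assumes "finite I" "finite Z" "card Z = card I"
    and "\<And>u. u \<in> Z \<Longrightarrow> (\<Sum>i\<in>I. a i * exp (\<mu> i * u)) = 0"
  shows "(\<Sum>i\<in>I. a i * exp (\<mu> i * u)) = 0"
  using assms
proof (induction I arbitrary: a \<mu> Z u rule: finite_induct)
  case empty
  then show ?case by simp
next
  case (insert k I)
  define g where "g u = (\<Sum>i\<in>insert k I. a i * exp ((\<mu> i - \<mu> k) * u))" for u
  define g' where "g' u = (\<Sum>i\<in>I. (a i * (\<mu> i - \<mu> k)) * exp ((\<mu> i - \<mu> k) * u))" for u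
  have shift: "(\<Sum>i\<in>insert k I. a i * exp (\<mu> i * u)) = exp (\<mu> k * u) * g u" for u
    unfolding g_def sum_distrib_left by (intro sum.cong) (auto simp: algebra_simps simp flip: exp_add)
  have der: "(g has_real_derivative g' u) (at u)" for u
    unfolding g_def g'_def using insert.hyps
    by (auto intro!: derivative_eq_intros sum.cong)
  have gZ: "g u = 0" if "u \<in> Z" for u
    using insert.prems(3)[OF that] shift[of u] by simp
  have "Z \<noteq> {}" using insert by auto
  then obtain Y where Y: "finite Y" "card Z = Suc (card Y)" "\<And>u. u \<in> Y \<Longrightarrow> g' u = 0"
    using Rolle_finite_zeros[OF insert.prems(1) _ der gZ] by blast
  have "g' u = 0" for u
    unfolding g'_def
    by (rule insert.IH[of Y]) (use Y insert.prems insert.hyps in \<open>auto simp: g'_def\<close>)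
  then have "(g has_real_derivative 0) (at u)" for u using der[of u] by simp
  then have "g u = g v" for u v using DERIV_isconst_all by blast
  moreover obtain z where "z \<in> Z" using \<open>Z \<noteq> {}\<close> by blast
  ultimately have "g u = 0" using gZ by metis
  then show ?case by (simp add: shift)
qed

text \<open>
  The values of \<open>\<phi>\<close> fill an interval of length at least \<open>(N + 1) * pi\<close>, which contains \<open>N\<close> of the
  points \<open>pi/2 + k * pi\<close>.
\<close>

lemma cos_zeros_of_large_variation:
  fixes \<phi> :: "real \<Rightarrow> real"
  assumes "continuous_on {0..1} \<phi>" "\<bar>\<phi> 1 - \<phi> 0\<bar> \<ge> real (Suc N) * pi"
  shows "\<exists>Z. finite Z \<and> card Z = N \<and> (\<forall>u\<in>Z. u \<in> {0..1} \<and> cos (\<phi> u) = 0)"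
proof -
  define lo where "lo = min (\<phi> 0) (\<phi> 1)"
  define hi where "hi = max (\<phi> 0) (\<phi> 1)"
  have hl: "hi - lo \<ge> real (Suc N) * pi" using assms(2) by (auto simp: lo_def hi_def)
  \<comment> \<open>\<open>pi/2 + pi * m\<close> is the first zero of the cosine at or above \<open>lo\<close>.\<close>
  define m where "m = \<lceil>lo / pi - 1/2\<rceil>"
  define y where "y k = pi/2 + pi * (of_int m + real k)" for k :: nat
  have m: "lo / pi - 1/2 \<le> of_int m" "of_int m < lo / pi + 1/2"
    unfolding m_def by linarith+
  have "\<exists>u\<in>{0..1}. \<phi> u = y k" if "k < N" for k
  proof -
    have "pi * (lo / pi - 1/2) \<le> pi * of_int m"
      using m by (intro mult_left_mono) auto
    then have 1: "lo - pi/2 \<le> pi * of_int m" by (simp add: right_diff_distrib)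
    have "pi * of_int m \<le> pi * (lo / pi + 1/2)"
      using m by (intro mult_left_mono) auto
    then have 2: "pi * of_int m \<le> lo + pi/2" by (simp add: distrib_left)
    have "pi * real k \<ge> 0" by (intro mult_nonneg_nonneg) auto
    with 1 have "lo \<le> y k" unfolding y_def distrib_left by linarith
    have "pi * real (k + 1) \<le> pi * real N" using that by (intro mult_left_mono) auto
    then have "pi * real k + pi \<le> pi * real N" by (simp add: algebra_simps)
    moreover have "lo + pi * real N + pi \<le> hi" using hl by (simp add: algebra_simps)
    ultimately have "y k \<le> hi" using 2 pi_gt_zero unfolding y_def distrib_left by linarith
    show ?thesis
    proof (cases "\<phi> 0 \<le> \<phi> 1")
      case True
      then show ?thesis using IVT'[of \<phi> 0 "y k" 1] \<open>lo \<le> y k\<close> \<open>y k \<le> hi\<close> assms(1)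
        by (auto simp: lo_def hi_def)
    next
      case False
      then show ?thesis using IVT2'[of \<phi> 1 "y k" 0] \<open>lo \<le> y k\<close> \<open>y k \<le> hi\<close> assms(1)
        by (auto simp: lo_def hi_def)
    qed
  qed
  then obtain z where z: "\<And>k. k < N \<Longrightarrow> z k \<in> {0..1} \<and> \<phi> (z k) = y k" by metis
  have "inj_on z {..<N}"
  proof (rule inj_onI)
    fix k l assume "k \<in> {..<N}" "l \<in> {..<N}" "z k = z l"
    then have "y k = y l" using z[of k] z[of l] by auto
    then show "k = l" by (simp add: y_def)
  qed
  moreover have "cos (y k) = 0" for k
    unfolding y_def cos_zero_iff_int2
    by (intro exI[of _ "m + int k"]) (simp add: algebra_simps)
  ultimately show ?thesis
    using z by (intro exI[of _ "z ` {..<N}"]) (auto simp: card_image)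
qed

text \<open>
  Each time the argument passes an odd multiple of \<open>pi/2\<close>, the real part of the sum vanishes. This
  real part is itself a real exponential sum, so it has fewer than \<open>card I\<close> zeros unless it vanishes
  identically; in the latter case the argument cannot move continuously at all. The bound depends
  neither on the coefficients nor on the exponents.
\<close>

lemma argument_variation_exponential_sum:
  fixes \<phi> :: "real \<Rightarrow> real" and c :: "'i \<Rightarrow> complex" and \<mu> :: "'i \<Rightarrow> real"
  assumes "finite I" "continuous_on {0..1} \<phi>"
    and polar: "\<And>u. u \<in> {0..1} \<Longrightarrow> \<exists>r>0. (\<Sum>i\<in>I. c i * of_real (exp (\<mu> i * u))) = of_real r * cis (\<phi> u)"
  shows "\<bar>\<phi> 1 - \<phi> 0\<bar> \<le> real (card I + 2) * pi"
proof (rule ccontr)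
  assume "\<not> ?thesis"
  then have big: "\<bar>\<phi> 1 - \<phi> 0\<bar> > real (card I + 2) * pi" by simp
  define R where "R u = (\<Sum>i\<in>I. Re (c i) * exp (\<mu> i * u))" for u
  have R: "R u = 0 \<longleftrightarrow> cos (\<phi> u) = 0" if u: "u \<in> {0..1}" for u
  proof -
    obtain r where "r > 0" "(\<Sum>i\<in>I. c i * of_real (exp (\<mu> i * u))) = of_real r * cis (\<phi> u)"
      using polar[OF u] by blast
    then have "Re (\<Sum>i\<in>I. c i * of_real (exp (\<mu> i * u))) = r * cos (\<phi> u)" by simp
    then have "R u = r * cos (\<phi> u)" by (simp add: R_def)
    then show ?thesis using \<open>r > 0\<close> by simp
  qed
  have "real (Suc (card I)) * pi \<le> real (card I + 2) * pi" by (intro mult_right_mono) auto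
  with big have "real (Suc (card I)) * pi \<le> \<bar>\<phi> 1 - \<phi> 0\<bar>" by linarith
  from cos_zeros_of_large_variation[OF assms(2) this] obtain Z where
    Z: "finite Z" "card Z = card I" "\<And>u. u \<in> Z \<Longrightarrow> u \<in> {0..1} \<and> cos (\<phi> u) = 0" by auto
  have "R u = 0" for u
    unfolding R_def
    by (rule exponential_sum_zeros[OF assms(1) Z(1,2)]) (use Z R in \<open>auto simp: R_def\<close>)
  then have cos0: "cos (\<phi> u) = 0" if "u \<in> {0..1}" for u using R that by blast
  \<comment> \<open>The cosine vanishes along the whole range of \<open>\<phi>\<close>, which however contains a multiple of \<open>pi\<close>.\<close>
  define lo where "lo = min (\<phi> 0) (\<phi> 1)"
  define hi where "hi = max (\<phi> 0) (\<phi> 1)"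
  have "real (card I + 2) * pi \<ge> 2 * pi" by (intro mult_right_mono) auto
  with big have "2 * pi < \<bar>\<phi> 1 - \<phi> 0\<bar>" by linarith
  then have hl: "hi - lo > 2 * pi" by (auto simp: lo_def hi_def)
  define y where "y = pi * of_int \<lceil>lo / pi\<rceil>"
  have "lo / pi \<le> of_int \<lceil>lo / pi\<rceil>" "of_int \<lceil>lo / pi\<rceil> \<le> lo / pi + 1" by linarith+
  then have "pi * (lo / pi) \<le> y" "y \<le> pi * (lo / pi + 1)"
    unfolding y_def by (intro mult_left_mono; simp)+
  then have y: "lo \<le> y" "y \<le> lo + pi" by (simp_all add: distrib_left)
  have "y \<le> hi" using y hl pi_gt_zero by linarith
  obtain u where u: "u \<in> {0..1}" "\<phi> u = y"
  proof (cases "\<phi> 0 \<le> \<phi> 1")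
    case True
    then show ?thesis using IVT'[of \<phi> 0 y 1] y \<open>y \<le> hi\<close> assms(2) that
      by (auto simp: lo_def hi_def)
  next
    case False
    then show ?thesis using IVT2'[of \<phi> 1 y 0] y \<open>y \<le> hi\<close> assms(2) that
      by (auto simp: lo_def hi_def)
  qed
  have "sin y = 0" unfolding y_def by (simp add: sin_zero_iff_int2 mult.commute) 
  then have "cos y \<noteq> 0" using sin_cos_squared_add[of y] by auto
  then show False using cos0[OF u(1)] u(2) by simp
qed

section \<open>Lower bounds for completely nonvanishing polynomials\<close>

text \<open>
  The vectors \<open>v\<close> for which \<open>v \<bullet> X k\<close> converges form a subspace, on which the limit is a linear
  functional; extended to the whole space, it is the inner product with some \<open>x\<close>. The sequence
  itself may well be unbounded: \<open>x\<close> is its limit modulo the directions in which it diverges.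
\<close>

lemma limit_functional_representable:
  fixes X :: "nat \<Rightarrow> 'a::euclidean_space"
  shows "\<exists>x. \<forall>v. convergent (\<lambda>k. v \<bullet> X k) \<longrightarrow> (\<lambda>k. v \<bullet> X k) \<longlonglongrightarrow> v \<bullet> x"
proof -
  define W where "W = {v. convergent (\<lambda>k. v \<bullet> X k)}"
  obtain B where B: "B \<subseteq> W" "independent B" "W \<subseteq> span B" using basis_exists by metis
  obtain g :: "'a \<Rightarrow> real" where g: "linear g" "\<forall>b\<in>B. g b = lim (\<lambda>k. b \<bullet> X k)"
    using linear_independent_extend[OF B(2), of "\<lambda>b. lim (\<lambda>k. b \<bullet> X k)"] by blast
  have lim: "(\<lambda>k. v \<bullet> X k) \<longlonglongrightarrow> g v" if "v \<in> span B" for v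
    using that
  proof (induction rule: span_induct_alt)
    case base
    then show ?case using linear_0[OF g(1)] by simp
  next
    case (step c b v)
    then have "(\<lambda>k. b \<bullet> X k) \<longlonglongrightarrow> g b" using B(1) g(2) by (auto simp: W_def convergent_LIMSEQ_iff)
    then have "(\<lambda>k. c * (b \<bullet> X k) + v \<bullet> X k) \<longlonglongrightarrow> c * g b + g v"
      using step by (intro tendsto_intros)
    then show ?case using g(1) by (simp add: inner_simps linear_add linear_cmul)
  qed
  have "g v = v \<bullet> adjoint g 1" for v using adjoint_works[OF g(1), of v 1] by (simp add: inner_commute)
  then show ?thesis using lim B(3) W_def by (intro exI[of _ "adjoint g 1"]) (metis mem_Collect_eq subsetD)
qed

lemma bounded_family_convergent_subseq:
  fixes Y :: "'i \<Rightarrow> nat \<Rightarrow> real"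
  assumes "finite A" "\<And>i. i \<in> A \<Longrightarrow> bounded (range (Y i))"
  shows "\<exists>r. strict_mono r \<and> (\<forall>i\<in>A. convergent (\<lambda>k. Y i (r k)))"
  using assms
proof (induction A rule: finite_induct)
  case empty
  show ?case using strict_mono_id by blast
next
  case (insert a A)
  then obtain r where r: "strict_mono r" "\<forall>i\<in>A. convergent (\<lambda>k. Y i (r k))" by auto
  have "bounded (range (\<lambda>k. Y a (r k)))"
    using insert.prems[of a] bounded_subset[of "range (Y a)" "range (\<lambda>k. Y a (r k))"] by auto
  then obtain l q where q: "strict_mono q" "((\<lambda>k. Y a (r k)) \<circ> q) \<longlonglongrightarrow> l"
    using bounded_imp_convergent_subsequence by blast
  have "convergent (\<lambda>k. Y i (r (q k)))" if "i \<in> A" for i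
    using convergent_subseq_convergent[of "\<lambda>k. Y i (r k)" q] r(2) q(1) that by (auto simp: o_def)
  then show ?case using q r strict_mono_o[OF r(1) q(1)]
    by (intro exI[of _ "r \<circ> q"]) (auto simp: o_def convergent_def)
qed

lemma lookup_truncation:
  "Poly_Mapping.lookup (truncation g \<Gamma>) \<alpha> =
     (if real_exponent \<alpha> \<in> \<Gamma> then Poly_Mapping.lookup g \<alpha> else 0)"
proof -
  have "Poly_Mapping.lookup (truncation g \<Gamma>) \<alpha> =
    (\<Sum>\<beta> | \<beta> \<in> Poly_Mapping.keys g \<and> real_exponent \<beta> \<in> \<Gamma>. Poly_Mapping.lookup g \<beta> when \<beta> = \<alpha>)"
    by (simp add: truncation_def lookup_sum lookup_single)
  also have "\<dots> = (if real_exponent \<alpha> \<in> \<Gamma> then Poly_Mapping.lookup g \<alpha> else 0)"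
    by (auto simp: when_def in_keys_iff)
  finally show ?thesis .
qed

lemma keys_truncation:
  "Poly_Mapping.keys (truncation g \<Gamma>) = {\<alpha> \<in> Poly_Mapping.keys g. real_exponent \<alpha> \<in> \<Gamma>}"
  by (auto simp: in_keys_iff lookup_truncation split: if_splits)

lemma exp_vec_in_pos_orthant [simp]: "exp_vec x \<in> pos_orthant"
  by (simp add: pos_orthant_def exp_vec_def)

lemma peval_exp_vec:
  "peval g (cvec (exp_vec x)) =
     (\<Sum>\<alpha>\<in>Poly_Mapping.keys g. Poly_Mapping.lookup g \<alpha> * of_real (exp (real_exponent \<alpha> \<bullet> x)))"
proof -
  have "(\<Prod>j\<in>UNIV. complex_of_real (exp (x $ j)) ^ (\<alpha> $ j)) = of_real (exp (real_exponent \<alpha> \<bullet> x))" for \<alpha>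
    by (simp add: inner_vec_def real_exponent_def exp_sum exp_of_nat_mult del: of_real_exp
        flip: of_real_power)
  then show ?thesis by (simp add: peval_def cvec_def exp_vec_def del: of_real_exp)
qed

lemma peval_truncation_exp_vec:
  "peval (truncation g \<Gamma>) (cvec (exp_vec x)) =
     (\<Sum>\<alpha> | \<alpha> \<in> Poly_Mapping.keys g \<and> real_exponent \<alpha> \<in> \<Gamma>.
        Poly_Mapping.lookup g \<alpha> * of_real (exp (real_exponent \<alpha> \<bullet> x)))"
  unfolding peval_exp_vec keys_truncation by (intro sum.cong) (auto simp: lookup_truncation)

text \<open>
  If an inner point of a segment stays bounded below under the nonpositive affine maps \<open>\<l> k\<close>, then so
  do both end points, because neither can compensate for the other one. In this way a sequence of
  linear functionals, without being convergent itself, singles out a face.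
\<close>

lemma face_of_bounded_below:
  fixes \<l> :: "nat \<Rightarrow> 'a::real_vector \<Rightarrow> real"
  assumes "convex P"
    and affine: "\<And>k a b \<theta>. \<l> k ((1 - \<theta>) *\<^sub>R a + \<theta> *\<^sub>R b) = (1 - \<theta>) * \<l> k a + \<theta> * \<l> k b"
    and nonpos: "\<And>k p. p \<in> P \<Longrightarrow> \<l> k p \<le> 0"
  shows "{p \<in> P. \<exists>B. \<forall>k. B \<le> \<l> k p} face_of P"
proof -
  let ?F = "{p \<in> P. \<exists>B. \<forall>k. B \<le> \<l> k p}"
  have "convex ?F"
    unfolding convex_alt
  proof (intro ballI allI impI)
    fix a b :: 'a and \<theta> :: real assume *: "a \<in> ?F" "b \<in> ?F" "0 \<le> \<theta> \<and> \<theta> \<le> 1"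
    then obtain A B where AB: "\<And>k. A \<le> \<l> k a" "\<And>k. B \<le> \<l> k b" by blast
    have "(1 - \<theta>) * A + \<theta> * B \<le> \<l> k ((1 - \<theta>) *\<^sub>R a + \<theta> *\<^sub>R b)" for k
      unfolding affine using * AB by (intro add_mono mult_left_mono) auto
    then show "(1 - \<theta>) *\<^sub>R a + \<theta> *\<^sub>R b \<in> ?F"
      using * \<open>convex P\<close> unfolding convex_alt by blast
  qed
  moreover have left: "a \<in> ?F" if "a \<in> P" "b \<in> P" "x \<in> ?F" "x = (1 - \<theta>) *\<^sub>R a + \<theta> *\<^sub>R b" "0 < \<theta>" "\<theta> < 1"
    for a b x \<theta>
  proof -
    obtain B where B: "\<And>k. B \<le> \<l> k x" using \<open>x \<in> ?F\<close> by blast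
    have "B / (1 - \<theta>) \<le> \<l> k a" for k
    proof -
      have "\<theta> * \<l> k b \<le> 0" using that nonpos[of b k] by (simp add: mult_le_0_iff)
      then have "B \<le> (1 - \<theta>) * \<l> k a" using B[of k] affine[of k \<theta> a b] that by simp
      then show ?thesis using that by (simp add: field_simps)
    qed
    then show ?thesis using that by blast
  qed
  moreover have "b \<in> ?F" if "a \<in> P" "b \<in> P" "x \<in> ?F" "x = (1 - \<theta>) *\<^sub>R a + \<theta> *\<^sub>R b" "0 < \<theta>" "\<theta> < 1"
    for a b x \<theta>
    by (rule left[of b a x "1 - \<theta>"]) (use that in \<open>auto simp: add.commute\<close>)
  ultimately show ?thesis
    unfolding face_of_def in_segment by blast
qed

text \<open>
  Suppose that \<open>g (e\<^sup>x)\<close> is not comparable from below with its largest monomial \<open>exp (h x)\<close> along some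
  sequence \<open>X\<close>. Along a subsequence each quotient \<open>exp (real_exponent \<alpha> \<bullet> X k - h (X k))\<close>, which is at
  most \<open>1\<close>, has a limit \<open>w \<alpha>\<close>. The exponents with \<open>w \<alpha> > 0\<close> are exactly those on a nonempty face
  \<open>\<Gamma>\<close>. Differences of such exponents have convergent pairings with \<open>X\<close>, so there is a point \<open>x\<close> such
  that the \<open>w \<alpha>\<close> are, up to one common positive factor, the values of the monomials on \<open>\<Gamma>\<close> at \<open>e\<^sup>x\<close>.
  Hence the scaled values of \<open>g\<close> tend to a positive multiple of the truncation of \<open>g\<close> to \<open>\<Gamma>\<close> at
  \<open>e\<^sup>x\<close>, which is not zero.
\<close>

lemma completely_nonvanishing_lower_bound:
  fixes g :: "'n::finite cmpoly"
  assumes cn: "completely_nonvanishing g (cvec ` pos_orthant)"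
  shows "\<exists>c>0. \<forall>x. \<forall>\<alpha>\<in>Poly_Mapping.keys g.
           c * exp (real_exponent \<alpha> \<bullet> x) \<le> norm (peval g (cvec (exp_vec x)))"
proof (rule ccontr)
  let ?K = "Poly_Mapping.keys g"
  define G where "G x = peval g (cvec (exp_vec x))" for x
  assume "\<not> ?thesis"
  then have "\<exists>x. \<exists>\<alpha>\<in>?K. norm (G x) < inverse (real (Suc k)) * exp (real_exponent \<alpha> \<bullet> x)" for k
    unfolding G_def by (meson inverse_positive_iff_positive linorder_not_less of_nat_0_less_iff zero_less_Suc)
  then obtain X0 A0 where X0: "\<And>k. A0 k \<in> ?K"
    "\<And>k. norm (G (X0 k)) < inverse (real (Suc k)) * exp (real_exponent (A0 k) \<bullet> X0 k)" by metis
  define h where "h x = Max ((\<lambda>\<alpha>. real_exponent \<alpha> \<bullet> x) ` ?K)" for x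
  have ne: "?K \<noteq> {}" using X0(1) by blast
  have h_ge: "real_exponent \<alpha> \<bullet> x \<le> h x" if "\<alpha> \<in> ?K" for \<alpha> x
    unfolding h_def using that by simp
  have h_in: "\<exists>\<alpha>\<in>?K. h x = real_exponent \<alpha> \<bullet> x" for x
  proof -
    have "h x \<in> (\<lambda>\<alpha>. real_exponent \<alpha> \<bullet> x) ` ?K"
      unfolding h_def by (rule Max_in) (use ne in auto)
    then show ?thesis by blast
  qed
  define Y where "Y \<alpha> k = exp (real_exponent \<alpha> \<bullet> X0 k - h (X0 k))" for \<alpha> k
  have "bounded (range (Y \<alpha>))" if "\<alpha> \<in> ?K" for \<alpha>
    unfolding bounded_iff by (rule exI[of _ 1]) (use h_ge that in \<open>auto simp: Y_def\<close>)
  then obtain r where r: "strict_mono r" "\<And>\<alpha>. \<alpha> \<in> ?K \<Longrightarrow> convergent (\<lambda>k. Y \<alpha> (r k))"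
    using bounded_family_convergent_subseq[of ?K Y] by auto
  define X where "X k = X0 (r k)" for k
  define \<l> where "\<l> k p = p \<bullet> X k - h (X k)" for k p
  have "\<exists>w. \<forall>\<alpha>\<in>?K. (\<lambda>k. exp (\<l> k (real_exponent \<alpha>))) \<longlonglongrightarrow> w \<alpha>"
    using r(2) unfolding Y_def convergent_def \<l>_def X_def by (intro bchoice) blast
  then obtain w where w: "\<And>\<alpha>. \<alpha> \<in> ?K \<Longrightarrow> (\<lambda>k. exp (\<l> k (real_exponent \<alpha>))) \<longlonglongrightarrow> w \<alpha>" by blast
  have w_ge: "w \<alpha> \<ge> 0" if "\<alpha> \<in> ?K" for \<alpha>
    by (rule LIMSEQ_le_const[OF w[OF that]]) auto
  define \<Gamma> where "\<Gamma> = {p \<in> newton_polytope g. \<exists>B. \<forall>k. B \<le> \<l> k p}"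
  have nonpos: "\<l> k p \<le> 0" if "p \<in> newton_polytope g" for k p
  proof -
    have "newton_polytope g \<subseteq> {p. X k \<bullet> p \<le> h (X k)}"
      unfolding newton_polytope_def
    proof (rule hull_minimal)
      show "real_exponent ` ?K \<subseteq> {p. X k \<bullet> p \<le> h (X k)}" using h_ge[of _ "X k"] by (auto simp: inner_commute[of "X k"])
    qed (rule convex_halfspace_le)
    then show ?thesis using that by (auto simp: \<l>_def inner_commute)
  qed
  have face: "\<Gamma> face_of newton_polytope g"
    unfolding \<Gamma>_def
  proof (rule face_of_bounded_below)
    show "convex (newton_polytope g)" by (simp add: newton_polytope_def)
  qed (auto simp: nonpos, simp add: \<l>_def inner_simps algebra_simps)
  have K_sub: "real_exponent \<alpha> \<in> newton_polytope g" if "\<alpha> \<in> ?K" for \<alpha>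
    using that by (auto simp: newton_polytope_def hull_inc)
  have in_\<Gamma>: "real_exponent \<alpha> \<in> \<Gamma> \<longleftrightarrow> w \<alpha> > 0" if "\<alpha> \<in> ?K" for \<alpha>
  proof
    assume "real_exponent \<alpha> \<in> \<Gamma>"
    then obtain B where "\<And>k. B \<le> \<l> k (real_exponent \<alpha>)" by (auto simp: \<Gamma>_def)
    then have "exp B \<le> w \<alpha>" by (intro LIMSEQ_le_const[OF w[OF that]]) auto
    then show "w \<alpha> > 0" by (meson exp_gt_zero less_le_trans)
  next
    assume "w \<alpha> > 0"
    then have "(\<lambda>k. ln (exp (\<l> k (real_exponent \<alpha>)))) \<longlonglongrightarrow> ln (w \<alpha>)"
      by (intro tendsto_ln w that) auto
    then have "Bseq (\<lambda>k. \<l> k (real_exponent \<alpha>))" by (auto intro: convergent_imp_Bseq convergentI)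
    then obtain B where "\<And>k. \<bar>\<l> k (real_exponent \<alpha>)\<bar> \<le> B" by (auto simp: Bseq_def)
    then have "- B \<le> \<l> k (real_exponent \<alpha>)" for k using abs_le_D2 minus_le_iff by blast
    then show "real_exponent \<alpha> \<in> \<Gamma>" using K_sub that by (auto simp: \<Gamma>_def)
  qed
  \<comment> \<open>For each \<open>k\<close> some quotient equals \<open>1\<close>, so the limits cannot all be zero.\<close>
  have "\<exists>\<beta>\<in>?K. w \<beta> > 0"
  proof (rule ccontr)
    assume "\<not> ?thesis"
    then have "w \<alpha> = 0" if "\<alpha> \<in> ?K" for \<alpha> using w_ge[OF that] that by force
    then have "(\<lambda>k. \<Sum>\<alpha>\<in>?K. exp (\<l> k (real_exponent \<alpha>))) \<longlonglongrightarrow> (\<Sum>\<alpha>\<in>?K. 0)"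
      using w by (intro tendsto_sum) fastforce
    moreover have "1 \<le> (\<Sum>\<alpha>\<in>?K. exp (\<l> k (real_exponent \<alpha>)))" for k
    proof -
      obtain \<alpha> where "\<alpha> \<in> ?K" "h (X k) = real_exponent \<alpha> \<bullet> X k" using h_in by blast
      then have "exp (\<l> k (real_exponent \<alpha>)) = 1" by (simp add: \<l>_def)
      then show ?thesis using member_le_sum[of \<alpha> ?K "\<lambda>\<alpha>. exp (\<l> k (real_exponent \<alpha>))"] \<open>\<alpha> \<in> ?K\<close> by auto
    qed
    ultimately have "1 \<le> (\<Sum>\<alpha>\<in>?K. 0::real)" by (intro LIMSEQ_le_const) auto
    then show False by simp
  qed
  then obtain \<beta> where \<beta>: "\<beta> \<in> ?K" "w \<beta> > 0" by blast
  obtain x where x: "\<And>v. convergent (\<lambda>k. v \<bullet> X k) \<Longrightarrow> (\<lambda>k. v \<bullet> X k) \<longlonglongrightarrow> v \<bullet> x"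
    using limit_functional_representable by metis
  have w_eq: "w \<alpha> = w \<beta> * exp (- (real_exponent \<beta> \<bullet> x)) * exp (real_exponent \<alpha> \<bullet> x)"
    if \<alpha>: "\<alpha> \<in> ?K" "w \<alpha> > 0" for \<alpha>
  proof -
    have lnlim: "(\<lambda>k. \<l> k (real_exponent \<gamma>)) \<longlonglongrightarrow> ln (w \<gamma>)" if "\<gamma> \<in> ?K" "w \<gamma> > 0" for \<gamma>
      using tendsto_ln[OF w[OF that(1)]] that(2) by simp
    have "(\<lambda>k. \<l> k (real_exponent \<alpha>) - \<l> k (real_exponent \<beta>)) \<longlonglongrightarrow> ln (w \<alpha>) - ln (w \<beta>)"
      by (intro tendsto_diff lnlim \<alpha> \<beta>)
    then have *: "(\<lambda>k. (real_exponent \<alpha> - real_exponent \<beta>) \<bullet> X k) \<longlonglongrightarrow> ln (w \<alpha>) - ln (w \<beta>)"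
      by (simp add: \<l>_def inner_diff_left)
    then have "(real_exponent \<alpha> - real_exponent \<beta>) \<bullet> x = ln (w \<alpha>) - ln (w \<beta>)"
      using x convergentI LIMSEQ_unique by blast
    then have "exp (ln (w \<alpha>)) = exp (ln (w \<beta>) - real_exponent \<beta> \<bullet> x + real_exponent \<alpha> \<bullet> x)"
      by (simp add: inner_diff_left algebra_simps)
    then show ?thesis using \<alpha> \<beta> by (simp add: exp_add exp_diff exp_minus field_simps)
  qed
  define S where "S = (\<Sum>\<alpha>\<in>?K. Poly_Mapping.lookup g \<alpha> * of_real (w \<alpha>))"
  have S_eq: "S = of_real (w \<beta> * exp (- (real_exponent \<beta> \<bullet> x))) * peval (truncation g \<Gamma>) (cvec (exp_vec x))"
  proof -
    have "S = (\<Sum>\<alpha> | \<alpha> \<in> ?K \<and> real_exponent \<alpha> \<in> \<Gamma>. Poly_Mapping.lookup g \<alpha> * of_real (w \<alpha>))"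
      unfolding S_def
      by (rule sum.mono_neutral_right) (use in_\<Gamma> w_ge in \<open>fastforce simp: less_le\<close>)+
    also have "\<dots> = (\<Sum>\<alpha> | \<alpha> \<in> ?K \<and> real_exponent \<alpha> \<in> \<Gamma>. Poly_Mapping.lookup g \<alpha> *
        of_real (w \<beta> * exp (- (real_exponent \<beta> \<bullet> x)) * exp (real_exponent \<alpha> \<bullet> x)))"
      using in_\<Gamma> w_eq by (intro sum.cong refl) (metis (mono_tags, lifting) mem_Collect_eq)
    finally show ?thesis
      by (simp add: peval_truncation_exp_vec sum_distrib_left mult_ac del: of_real_exp)
  qed
  have "\<Gamma> \<noteq> {}" using in_\<Gamma> \<beta> by blast
  then have "S \<noteq> 0"
    using cn face \<beta>(2) unfolding S_eq completely_nonvanishing_def by auto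
  moreover have "S = 0"
  proof -
    have G_eq: "of_real (exp (- h (X k))) * G (X k) =
        (\<Sum>\<alpha>\<in>?K. Poly_Mapping.lookup g \<alpha> * of_real (exp (\<l> k (real_exponent \<alpha>))))" for k
      unfolding G_def peval_exp_vec sum_distrib_left
      by (intro sum.cong) (auto simp: \<l>_def exp_diff exp_minus field_simps)
    have "(\<lambda>k. of_real (exp (- h (X k))) * G (X k)) \<longlonglongrightarrow> S"
      unfolding G_eq S_def by (intro tendsto_sum tendsto_mult tendsto_const tendsto_of_real w)
    moreover have "(\<lambda>k. of_real (exp (- h (X k))) * G (X k)) \<longlonglongrightarrow> 0"
    proof (rule Lim_null_comparison)
      show "(\<lambda>k. inverse (real (Suc (r k)))) \<longlonglongrightarrow> 0"
        using LIMSEQ_subseq_LIMSEQ[OF LIMSEQ_inverse_real_of_nat r(1)] by (simp add: o_def)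
      show "\<forall>\<^sub>F k in sequentially. norm (of_real (exp (- h (X k))) * G (X k)) \<le> inverse (real (Suc (r k)))"
      proof (intro always_eventually allI)
        fix k
        have "norm (G (X k)) \<le> inverse (real (Suc (r k))) * exp (real_exponent (A0 (r k)) \<bullet> X k)"
          using X0(2)[of "r k"] unfolding X_def by simp
        also have "\<dots> \<le> inverse (real (Suc (r k))) * exp (h (X k))"
          by (intro mult_left_mono) (auto simp: h_ge X0(1))
        finally show "norm (of_real (exp (- h (X k))) * G (X k)) \<le> inverse (real (Suc (r k)))"
          by (simp add: norm_mult norm_divide exp_minus divide_simps)
      qed
    qed
    ultimately show ?thesis using LIMSEQ_unique by blast
  qed
  ultimately show False by simp
qed

section \<open>Power series of Laplace transforms\<close>

lemma has_sum_prod_vec: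
  fixes f :: "'k::finite \<Rightarrow> nat \<Rightarrow> 'c::{real_normed_field,banach,second_countable_topology}"
  assumes "\<And>j. summable (\<lambda>n. norm (f j n))"
  shows "((\<lambda>\<alpha>::nat^'k. \<Prod>j\<in>UNIV. f j (\<alpha> $ j)) has_sum (\<Prod>j\<in>UNIV. suminf (f j))) UNIV"
proof -
  have abs: "Infinite_Set_Sum.abs_summable_on (f j) UNIV" for j
    using assms by (simp add: abs_summable_on_nat_iff')
  have 1: "Infinite_Set_Sum.abs_summable_on (\<lambda>g. \<Prod>j\<in>UNIV. f j (g j)) (PiE UNIV (\<lambda>_::'k. UNIV::nat set))"
    by (rule abs_summable_on_prod_PiE) (use abs in auto)
  have "((\<lambda>g. \<Prod>j\<in>UNIV. f j (g j)) has_sum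
      infsetsum (\<lambda>g. \<Prod>j\<in>UNIV. f j (g j)) (PiE UNIV (\<lambda>_::'k. UNIV::nat set))) (PiE UNIV (\<lambda>_. UNIV))"
    unfolding infsetsum_infsum[OF 1]
    by (rule has_sum_infsum[OF abs_summable_summable[OF abs_summable_equivalent[THEN iffD2, OF 1]]])
  moreover have "infsetsum (\<lambda>g. \<Prod>j\<in>UNIV. f j (g j)) (PiE UNIV (\<lambda>_::'k. UNIV::nat set)) =
      (\<Prod>j\<in>UNIV. infsetsum (f j) UNIV)"
    by (rule infsetsum_prod_PiE) (use abs in auto)
  moreover have "infsetsum (f j) UNIV = (suminf (f j))" for j
    using abs by (rule infsetsum_nat')
  ultimately have "((\<lambda>g. \<Prod>j\<in>UNIV. f j (g j)) has_sum (\<Prod>j\<in>UNIV. suminf (f j))) UNIV"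
    by (simp add: PiE_UNIV_domain)
  moreover have "bij_betw (vec_nth :: nat^'k \<Rightarrow> 'k \<Rightarrow> nat) UNIV UNIV"
    by (rule bij_betw_byWitness[where f' = vec_lambda]) auto
  ultimately show ?thesis
    using has_sum_reindex_bij_betw[of vec_nth UNIV UNIV "\<lambda>g. \<Prod>j\<in>UNIV. f j (g j)"] by simp
qed

lemma has_sum_exp_multi:
  fixes z :: "'k::finite \<Rightarrow> 'c::{real_normed_field,banach,second_countable_topology}"
  shows "((\<lambda>\<alpha>::nat^'k. (\<Prod>j\<in>UNIV. z j ^ (\<alpha> $ j) /\<^sub>R fact (\<alpha> $ j))) has_sum exp (\<Sum>j\<in>UNIV. z j)) UNIV"
proof -
  have "((\<lambda>\<alpha>::nat^'k. (\<Prod>j\<in>UNIV. z j ^ (\<alpha> $ j) /\<^sub>R fact (\<alpha> $ j))) has_sum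
      (\<Prod>j\<in>UNIV. suminf (\<lambda>n. z j ^ n /\<^sub>R fact n))) UNIV"
    by (rule has_sum_prod_vec[of "\<lambda>j n. z j ^ n /\<^sub>R fact n"]) (rule summable_norm_exp)
  moreover have "exp (\<Sum>j\<in>UNIV. z j) = (\<Prod>j\<in>UNIV. suminf (\<lambda>n. z j ^ n /\<^sub>R fact n))"
    by (subst exp_sum) (simp_all add: exp_def)
  ultimately show ?thesis by simp
qed

lemma exists_bij_nat_multiindex: "\<exists>e :: nat \<Rightarrow> nat^'k::finite. bij e"
proof -
  have "range (\<lambda>n::nat. (\<chi> j. n) :: nat^'k) \<subseteq> UNIV" "inj (\<lambda>n::nat. (\<chi> j. n) :: nat^'k)"
    by (auto simp: inj_on_def vec_eq_iff)
  then have "infinite (UNIV :: (nat^'k) set)"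
    using finite_imageD infinite_UNIV_nat finite_subset by metis
  then show ?thesis using bij_betw_from_nat_into[of "UNIV :: (nat^'k) set"] by auto
qed

text \<open>
  Expanding \<open>exp (\<langle>w - a, \<l> x\<rangle>)\<close> into its multivariate Taylor series gives the power series of the
  transform around \<open>a\<close>, with the moments of \<open>\<l>\<close> as coefficients. On the polydisc of radius \<open>r\<close> the
  absolute values of the terms add up to at most \<open>exp (r * (\<Sum>j\<in>UNIV. norm (\<l> x $ j)))\<close>, so the
  hypothesis is just what is needed to interchange sum and integral.
\<close>

theorem laplace_transform_power_series:
  fixes \<l> :: "'a \<Rightarrow> complex ^ 'k::finite" and a :: "complex ^ 'k"
  assumes [measurable]: "\<And>j. (\<lambda>x. \<l> x $ j) \<in> borel_measurable M"
    and int: "integrable M (\<lambda>x. norm (exp (\<Sum>j\<in>UNIV. a $ j * \<l> x $ j)) * exp (r * (\<Sum>j\<in>UNIV. norm (\<l> x $ j))))"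
  shows "\<exists>c. \<forall>w. (\<forall>j. norm (w $ j - a $ j) < r) \<longrightarrow>
           ((\<lambda>\<alpha>. c \<alpha> * (\<Prod>j\<in>UNIV. (w $ j - a $ j) ^ (\<alpha> $ j))) has_sum
              (LINT x|M. exp (\<Sum>j\<in>UNIV. w $ j * \<l> x $ j))) UNIV"
proof -
  define E where "E x = exp (\<Sum>j\<in>UNIV. a $ j * \<l> x $ j)" for x
  define c where "c \<alpha> = (LINT x|M. E x * (\<Prod>j\<in>UNIV. \<l> x $ j ^ (\<alpha> $ j) /\<^sub>R fact (\<alpha> $ j)))" for \<alpha> :: "nat^'k"
  \<comment> \<open>An enumeration of the multi-indices turns the sum into an ordinary series.\<close>
  obtain e :: "nat \<Rightarrow> nat^'k" where e: "bij e" using exists_bij_nat_multiindex by blast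
  have [measurable]: "E \<in> borel_measurable M" unfolding E_def by measurable
  have int': "integrable M (\<lambda>x. norm (E x) * exp (r * (\<Sum>j\<in>UNIV. norm (\<l> x $ j))))"
    using int by (simp add: E_def)
  show ?thesis
  proof (intro exI[of _ c] allI impI)
    fix w :: "complex ^ 'k" assume w: "\<forall>j. norm (w $ j - a $ j) < r"
    define P where "P = (\<lambda>\<alpha> x. \<Prod>j\<in>UNIV. ((w $ j - a $ j) * \<l> x $ j) ^ (\<alpha> $ j) /\<^sub>R fact (\<alpha> $ j))"
    define T where "T = (\<lambda>\<alpha> x. E x * P \<alpha> x)"
    have [measurable]: "T \<alpha> \<in> borel_measurable M" for \<alpha> unfolding T_def P_def by measurable
    have nP: "norm (P \<alpha> x) = (\<Prod>j\<in>UNIV. norm ((w $ j - a $ j) * \<l> x $ j) ^ (\<alpha> $ j) /\<^sub>R fact (\<alpha> $ j))" for \<alpha> x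
      unfolding P_def prod_norm[symmetric] by (simp add: norm_power mult.commute)
    have sumP: "((\<lambda>\<alpha>. P \<alpha> x) has_sum exp (\<Sum>j\<in>UNIV. (w $ j - a $ j) * \<l> x $ j)) UNIV" for x
      unfolding P_def by (rule has_sum_exp_multi)
    have sumnP: "((\<lambda>\<alpha>. norm (P \<alpha> x)) has_sum exp (\<Sum>j\<in>UNIV. norm ((w $ j - a $ j) * \<l> x $ j))) UNIV" for x
      unfolding nP by (rule has_sum_exp_multi)
    have sumT: "((\<lambda>n. T (e n) x) has_sum exp (\<Sum>j\<in>UNIV. w $ j * \<l> x $ j)) UNIV" for x
    proof -
      have "((\<lambda>\<alpha>. T \<alpha> x) has_sum E x * exp (\<Sum>j\<in>UNIV. (w $ j - a $ j) * \<l> x $ j)) UNIV"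
        unfolding T_def by (intro has_sum_cmult_right sumP)
      moreover have "E x * exp (\<Sum>j\<in>UNIV. (w $ j - a $ j) * \<l> x $ j) = exp (\<Sum>j\<in>UNIV. w $ j * \<l> x $ j)"
        unfolding E_def by (simp add: algebra_simps sum_subtractf sum.distrib flip: exp_add)
      ultimately show ?thesis
        using has_sum_reindex_bij_betw[OF e, of "\<lambda>\<alpha>. T \<alpha> x"] by simp
    qed
    have sumnT: "((\<lambda>n. norm (T (e n) x)) has_sum norm (E x) * exp (\<Sum>j\<in>UNIV. norm ((w $ j - a $ j) * \<l> x $ j))) UNIV" for x
    proof -
      have "((\<lambda>\<alpha>. norm (T \<alpha> x)) has_sum norm (E x) * exp (\<Sum>j\<in>UNIV. norm ((w $ j - a $ j) * \<l> x $ j))) UNIV"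
        unfolding T_def norm_mult[of "E x"] by (intro has_sum_cmult_right sumnP)
      then show ?thesis
        using has_sum_reindex_bij_betw[OF e, of "\<lambda>\<alpha>. norm (T \<alpha> x)"] by simp
    qed
    have le: "norm (E x) * exp (\<Sum>j\<in>UNIV. norm ((w $ j - a $ j) * \<l> x $ j)) \<le>
        norm (E x) * exp (r * (\<Sum>j\<in>UNIV. norm (\<l> x $ j)))" for x
    proof -
      have "(\<Sum>j\<in>UNIV. norm ((w $ j - a $ j) * \<l> x $ j)) \<le> (\<Sum>j\<in>UNIV. r * norm (\<l> x $ j))"
        unfolding norm_mult using w by (intro sum_mono mult_right_mono) (auto intro: less_imp_le)
      then show ?thesis by (intro mult_left_mono) (auto simp: sum_distrib_left)
    qed
    have fin_le: "(\<Sum>n<N. norm (T (e n) x)) \<le> norm (E x) * exp (r * (\<Sum>j\<in>UNIV. norm (\<l> x $ j)))" for N x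
    proof -
      have "(\<Sum>n<N. norm (T (e n) x)) \<le> norm (E x) * exp (\<Sum>j\<in>UNIV. norm ((w $ j - a $ j) * \<l> x $ j))"
        using has_sum_imp_sums[OF sumnT[of x]] by (intro sum_le_suminf[THEN order_trans]) (auto simp: sums_iff)
      then show ?thesis using le[of x] by linarith
    qed
    have intT: "integrable M (T (e n))" for n
    proof (rule Bochner_Integration.integrable_bound[OF int'])
      have "norm (T (e n) x) \<le> (\<Sum>k<Suc n. norm (T (e k) x))" for x
        by (rule member_le_sum) auto
      then have "norm (T (e n) x) \<le> norm (E x) * exp (r * (\<Sum>j\<in>UNIV. norm (\<l> x $ j)))" for x
        using fin_le[where N = "Suc n" and x = x] by (meson order_trans)
      then show "AE x in M. norm (T (e n) x) \<le> norm (norm (E x) * exp (r * (\<Sum>j\<in>UNIV. norm (\<l> x $ j))))"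
        by (intro always_eventually allI) (simp add: abs_mult)
    qed simp
    define I where "I n = (LINT x|M. norm (T (e n) x))" for n
    have sumI: "summable I"
    proof (rule summableI_nonneg_bounded)
      show "0 \<le> I n" for n unfolding I_def by simp
      show "(\<Sum>i<N. I i) \<le> (LINT x|M. norm (E x) * exp (r * (\<Sum>j\<in>UNIV. norm (\<l> x $ j))))" for N
      proof -
        have "(\<Sum>i<N. I i) = (LINT x|M. (\<Sum>i<N. norm (T (e i) x)))"
          unfolding I_def by (intro Bochner_Integration.integral_sum[symmetric] integrable_norm intT)
        also have "\<dots> \<le> (LINT x|M. norm (E x) * exp (r * (\<Sum>j\<in>UNIV. norm (\<l> x $ j))))"
          by (intro integral_mono fin_le int' Bochner_Integration.integrable_sum integrable_norm intT)
        finally show ?thesis .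
      qed
    qed
    have 1: "(\<lambda>n. LINT x|M. T (e n) x) sums (LINT x|M. suminf (\<lambda>n. T (e n) x))"
      using intT sumI has_sum_imp_sums[OF sumnT] unfolding I_def
      by (intro sums_integral always_eventually allI) (auto simp: sums_iff)
    have 2: "summable (\<lambda>n. norm (LINT x|M. T (e n) x))"
      by (rule summable_comparison_test'[OF sumI, of 0]) (simp add: I_def)
    have "((\<lambda>n. LINT x|M. T (e n) x) has_sum (LINT x|M. suminf (\<lambda>n. T (e n) x))) UNIV"
      using 2 1 by (rule norm_summable_imp_has_sum)
    then have "((\<lambda>\<alpha>. LINT x|M. T \<alpha> x) has_sum (LINT x|M. suminf (\<lambda>n. T (e n) x))) UNIV"
      using has_sum_reindex_bij_betw[OF e, of "\<lambda>\<alpha>. LINT x|M. T \<alpha> x"] by simp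
    moreover have "suminf (\<lambda>n. T (e n) x) = exp (\<Sum>j\<in>UNIV. w $ j * \<l> x $ j)" for x
      using has_sum_imp_sums[OF sumT] by (simp add: sums_iff)
    moreover have "(LINT x|M. T \<alpha> x) = c \<alpha> * (\<Prod>j\<in>UNIV. (w $ j - a $ j) ^ (\<alpha> $ j))" for \<alpha>
    proof -
      have "T \<alpha> x = (E x * (\<Prod>j\<in>UNIV. \<l> x $ j ^ (\<alpha> $ j) /\<^sub>R fact (\<alpha> $ j))) * (\<Prod>j\<in>UNIV. (w $ j - a $ j) ^ (\<alpha> $ j))" for x
        unfolding T_def P_def mult.assoc prod.distrib[symmetric]
        by (intro arg_cong[where f = "(*) (E x)"] prod.cong) (simp_all add: power_mult_distrib)
      then show ?thesis unfolding c_def by simp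
    qed
    ultimately show "((\<lambda>\<alpha>. c \<alpha> * (\<Prod>j\<in>UNIV. (w $ j - a $ j) ^ (\<alpha> $ j))) has_sum
              (LINT x|M. exp (\<Sum>j\<in>UNIV. w $ j * \<l> x $ j))) UNIV" by simp
  qed
qed

section \<open>Integrability and the exponential substitution\<close>

text \<open>
  Since \<open>norm x\<close> is at least the average of the \<open>\<bar>x \<bullet> b\<bar>\<close>, the function is dominated by a product of
  one-dimensional exponentials.
\<close>

lemma integrable_exp_minus_norm:
  assumes "0 < \<delta>"
  shows "integrable lborel (\<lambda>x::'a::euclidean_space. exp (- \<delta> * norm x))"
proof -
  define d where "d = \<delta> / DIM('a)"
  have "d > 0" using assms by (simp add: d_def)
  have half: "(\<integral>\<^sup>+u. ennreal (exp (- d * u)) * indicator {0..} u \<partial>lborel) = ennreal (1 / d)"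
  proof -
    have "(\<integral>\<^sup>+u. ennreal (exp (- d * u)) * indicator {0..} u \<partial>lborel) = ennreal (0 - (- exp (- d * 0) / d))"
    proof (rule nn_integral_FTC_atLeast)
      show "((\<lambda>u. - exp (- d * u) / d) has_real_derivative exp (- d * u)) (at u)" for u
        using \<open>d > 0\<close> by (auto intro!: derivative_eq_intros)
      show "((\<lambda>u. - exp (- d * u) / d) \<longlongrightarrow> 0) at_top"
      proof -
        have "LIM u at_top. - d * u :> at_bot"
          using \<open>d > 0\<close> by (intro filterlim_tendsto_neg_mult_at_bot[OF tendsto_const _ filterlim_ident]) simp
        then have "((\<lambda>u. exp (- d * u)) \<longlongrightarrow> 0) at_top" by (rule filterlim_compose[OF exp_at_bot])
        from tendsto_divide[OF tendsto_minus[OF this] tendsto_const[of d]] \<open>d > 0\<close> show ?thesis by simp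
      qed
    qed auto
    then show ?thesis by simp
  qed
  have neg: "(\<integral>\<^sup>+u. ennreal (exp (d * u)) * indicator {..0} u \<partial>lborel) = ennreal (1 / d)"
    using nn_integral_real_affine[of "\<lambda>u. ennreal (exp (d * u)) * indicator {..0} u" "-1" 0] half
    by (simp add: indicator_def)
  have one: "(\<integral>\<^sup>+u. ennreal (exp (- d * \<bar>u\<bar>)) \<partial>lborel) < \<infinity>"
  proof -
    have "(\<integral>\<^sup>+u. ennreal (exp (- d * \<bar>u\<bar>)) \<partial>lborel) \<le>
        (\<integral>\<^sup>+u. ennreal (exp (- d * u)) * indicator {0..} u + ennreal (exp (d * u)) * indicator {..0} u \<partial>lborel)"
      by (intro nn_integral_mono) (auto simp: indicator_def abs_if)
    also have "\<dots> = ennreal (1 / d) + ennreal (1 / d)"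
      using half neg by (subst nn_integral_add) auto
    finally show ?thesis by (metis ennreal_add_eq_top ennreal_neq_top infinity_ennreal_def le_less_trans less_top)
  qed
  show ?thesis
  proof (rule integrableI_bounded)
    have "(\<integral>\<^sup>+(x::'a). ennreal (norm (exp (- \<delta> * norm x))) \<partial>lborel) \<le>
        (\<integral>\<^sup>+(x::'a). (\<Prod>b\<in>Basis. ennreal (exp (- d * \<bar>x \<bullet> b\<bar>))) \<partial>lborel)"
    proof (intro nn_integral_mono)
      fix x :: 'a
      have "(\<Sum>b\<in>(Basis::'a set). \<bar>x \<bullet> b\<bar>) \<le> (\<Sum>b\<in>(Basis::'a set). norm x)"
        by (intro sum_mono Basis_le_norm)
      then have "d * (\<Sum>b\<in>(Basis::'a set). \<bar>x \<bullet> b\<bar>) \<le> d * (DIM('a) * norm x)"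
        using \<open>d > 0\<close> by (intro mult_left_mono) auto
      also have "\<dots> = \<delta> * norm x" by (simp add: d_def)
      finally have "exp (- \<delta> * norm x) \<le> exp (- d * (\<Sum>b\<in>(Basis::'a set). \<bar>x \<bullet> b\<bar>))" by simp
      also have "\<dots> = (\<Prod>b\<in>(Basis::'a set). exp (- d * \<bar>x \<bullet> b\<bar>))"
        by (simp add: exp_sum sum_distrib_left flip: sum_negf)
      finally show "ennreal (norm (exp (- \<delta> * norm x))) \<le> (\<Prod>b\<in>Basis. ennreal (exp (- d * \<bar>x \<bullet> b\<bar>)))"
        by (subst prod_ennreal) (auto intro: ennreal_leI)
    qed
    also have "\<dots> = (\<Prod>b\<in>(Basis::'a set). \<integral>\<^sup>+u. ennreal (exp (- d * \<bar>u\<bar>)) \<partial>lborel)"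
      by (rule nn_integral_lborel_prod) auto
    also have "\<dots> < \<infinity>"
      using one ennreal_prod_eq_top[of "\<lambda>_. \<integral>\<^sup>+u. ennreal (exp (- d * \<bar>u\<bar>)) \<partial>lborel" "Basis::'a set"]
      by (auto simp: less_top[symmetric])
    finally show "(\<integral>\<^sup>+(x::'a). ennreal (norm (exp (- \<delta> * norm x))) \<partial>lborel) < \<infinity>" .
  qed simp
qed

lemma nn_integral_exp_substitution_Ioo:
  fixes a b :: real
  assumes "a \<le> b"
  shows "(\<integral>\<^sup>+u. ennreal (exp u) * indicator {a<..<b} (exp u) \<partial>lborel) = 
         (\<integral>\<^sup>+z. indicator {0<..} z * indicator {a<..<b} z \<partial>lborel)"
proof -
  have up: "(\<integral>\<^sup>+u. ennreal (exp u) * indicator {..ln c} u \<partial>lborel) = ennreal c" if "0 < c" for c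
  proof -
    have "(\<integral>\<^sup>+u. ennreal (exp (- u)) * indicator {- ln c..} u \<partial>lborel) = ennreal (0 - (- exp (- (- ln c))))"
    proof (rule nn_integral_FTC_atLeast)
      show "((\<lambda>u. - exp (- u)) has_real_derivative exp (- u)) (at u)" for u :: real
        by (auto intro!: derivative_eq_intros)
      show "((\<lambda>u::real. - exp (- u)) \<longlongrightarrow> 0) at_top" 
        using tendsto_minus[OF filterlim_compose[OF exp_at_bot filterlim_uminus_at_bot_at_top]] by simp
    qed auto
    then show ?thesis
      using nn_integral_real_affine[of "\<lambda>u. ennreal (exp u) * indicator {..ln c} u" "-1" 0] that
      by (simp add: indicator_def minus_le_iff)
  qed
  show ?thesis
  proof (cases "b \<le> 0")
    case True
    then have "\<not> exp u < b" for u using exp_gt_zero[of u] by linarith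
    then have "indicator {a<..<b} (exp u) = (0::ennreal)" for u
      by (simp add: indicator_def)
    moreover have "(\<lambda>z. indicator {0<..} z * indicator {a<..<b} z) = (\<lambda>z::real. 0::ennreal)"
      using True by (auto simp: indicator_def fun_eq_iff)
    ultimately show ?thesis by (simp del: nn_integral_indicator)
  next
    case False
    then have "b > 0" by simp
    have R: "(\<integral>\<^sup>+z. indicator {0<..} z * indicator {a<..<b} z \<partial>lborel) = ennreal (b - max 0 a)"
    proof -
      have "(\<integral>\<^sup>+z. indicator {0<..} z * indicator {a<..<b} z \<partial>lborel) = (\<integral>\<^sup>+z. indicator {max 0 a<..<b} z \<partial>lborel)"
        by (intro nn_integral_cong) (auto simp: indicator_def)
      then show ?thesis using \<open>b > 0\<close> assms by simp
    qed
    have AEb: "AE u in lborel. u \<noteq> ln b" by (rule AE_lborel_singleton)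
    show ?thesis
    proof (cases "a \<le> 0")
      case True
      have "(\<integral>\<^sup>+u. ennreal (exp u) * indicator {a<..<b} (exp u) \<partial>lborel) = (\<integral>\<^sup>+u. ennreal (exp u) * indicator {..ln b} u \<partial>lborel)"
      proof (rule nn_integral_cong_AE, use AEb in eventually_elim)
        case (elim u)
        have "a < exp u" using True exp_gt_zero[of u] by linarith
        moreover have "exp u < b \<longleftrightarrow> u \<le> ln b" using \<open>b > 0\<close> elim ln_ge_iff[of b u] by (metis exp_ln exp_less_cancel_iff less_le)
        ultimately show ?case by (simp add: indicator_def)
      qed
      then show ?thesis using up[OF \<open>b > 0\<close>] R True by simp
    next
      case False
      then have "a > 0" by simp
      have "(\<integral>\<^sup>+u. ennreal (exp u) * indicator {a<..<b} (exp u) \<partial>lborel) = (\<integral>\<^sup>+u. ennreal (exp u) * indicator {ln a..ln b} u \<partial>lborel)"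
      proof (rule nn_integral_cong_AE, use AEb AE_lborel_singleton[of "ln a"] in eventually_elim)
        case (elim u)
        have "exp u < b \<longleftrightarrow> u \<le> ln b" using \<open>b > 0\<close> elim by (metis exp_ln exp_less_cancel_iff less_le)
        moreover have "a < exp u \<longleftrightarrow> ln a \<le> u" using \<open>a > 0\<close> elim by (metis exp_ln exp_less_cancel_iff less_le)
        ultimately show ?case by (simp add: indicator_def)
      qed
      also have "\<dots> = exp (ln b) - exp (ln a)"
        by (rule nn_integral_FTC_Icc) (use \<open>a > 0\<close> assms in \<open>auto intro: DERIV_subset\<close>)
      finally show ?thesis using R \<open>a > 0\<close> \<open>b > 0\<close> by simp
    qed
  qed
qed

lemma prod_UNIV_eq_prod_Basis:
  fixes x :: "real^'n::finite" and f :: "real \<Rightarrow> 'b::comm_monoid_mult"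
  shows "(\<Prod>j\<in>UNIV. f (x $ j)) = (\<Prod>b\<in>Basis. f (x \<bullet> b))"
proof -
  have "(Basis :: (real^'n) set) = range (\<lambda>j. axis j 1)" by (auto simp: Basis_vec_def)
  moreover have "inj (\<lambda>j::'n. axis j (1::real))" by (auto simp: inj_on_def axis_eq_axis)
  ultimately show ?thesis
    using prod.reindex[of "\<lambda>j::'n. axis j (1::real)" UNIV "\<lambda>b. f (x \<bullet> b)"] by (simp add: inner_axis)
qed

lemma measurable_exp_vec [measurable]: "exp_vec \<in> borel_measurable borel"
  unfolding exp_vec_def by (intro borel_measurable_continuous_onI continuous_intros)

lemma pos_orthant_borel [measurable]: "(pos_orthant :: (real^'n::finite) set) \<in> sets borel"
proof -
  have "(pos_orthant :: (real^'n::finite) set) = (\<Inter>j. {z. 0 < z $ j})" by (auto simp: pos_orthant_def)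
  also have "open \<dots>" by (intro open_INT ballI finite) (simp add: open_Collect_less continuous_intros)
  finally show ?thesis by simp
qed

text \<open>
  This is the substitution \<open>z = e\<^sup>x\<close> with its Jacobian determinant, stated for measures. The map acts
  on each coordinate separately, so on boxes the claim is a product of one-dimensional statements,
  and boxes generate the Borel sets.
\<close>

lemma pos_orthant_as_distr:
  "density lborel (indicator (pos_orthant :: (real^'n::finite) set)) =
   distr (density lborel (\<lambda>x::real^'n. ennreal (\<Prod>j\<in>UNIV. exp (x $ j)))) borel exp_vec" (is "?N = ?D")
proof -
  have N: "emeasure ?N A = (\<integral>\<^sup>+z. indicator pos_orthant z * indicator A z \<partial>lborel)" if "A \<in> sets borel" for A
    using that by (simp add: emeasure_density)
  have D: "emeasure ?D A = (\<integral>\<^sup>+x. (\<Prod>j\<in>UNIV. ennreal (exp (x $ j))) * indicator A (exp_vec x) \<partial>lborel)"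
    if [measurable]: "A \<in> sets borel" for A
    using that by (simp add: emeasure_distr emeasure_density prod_ennreal indicator_vimage[symmetric]
      indicator_def vimage_def)
  have box_eq: "emeasure ?D (box a b) = emeasure ?N (box a b)" for a b :: "real^'n"
  proof (cases "\<forall>c\<in>Basis. a \<bullet> c \<le> b \<bullet> c")
    case True
    have exp_vec_inner: "exp_vec x \<bullet> c = exp (x \<bullet> c)" if "c \<in> Basis" for x c :: "real^'n"
      using that by (auto simp: Basis_vec_def exp_vec_def inner_axis)
    have ind: "indicator (box a b) x = (\<Prod>c\<in>Basis. indicator {a \<bullet> c<..<b \<bullet> c} (x \<bullet> c) :: ennreal)" for x
      by (auto simp: indicator_def box_def prod_zero_iff)
    have ind0: "indicator pos_orthant x = (\<Prod>c\<in>Basis. indicator {0<..} (x \<bullet> c) :: ennreal)" for x :: "real^'n"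
      unfolding prod_UNIV_eq_prod_Basis[symmetric] by (auto simp: indicator_def pos_orthant_def prod_zero_iff)
    have "emeasure ?D (box a b) = (\<integral>\<^sup>+x. (\<Prod>c\<in>Basis. ennreal (exp (x \<bullet> c)) * indicator {a \<bullet> c<..<b \<bullet> c} (exp (x \<bullet> c))) \<partial>lborel)"
      by (simp add: D ind exp_vec_inner prod.distrib prod_UNIV_eq_prod_Basis[of "\<lambda>u. ennreal (exp u)"])
    also have "\<dots> = (\<Prod>c\<in>Basis. \<integral>\<^sup>+u. ennreal (exp u) * indicator {a \<bullet> c<..<b \<bullet> c} (exp u) \<partial>lborel)"
      by (rule nn_integral_lborel_prod) auto
    also have "\<dots> = (\<Prod>c\<in>Basis. \<integral>\<^sup>+z. indicator {0<..} z * indicator {a \<bullet> c<..<b \<bullet> c} z \<partial>lborel)"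
      using True by (intro prod.cong refl nn_integral_exp_substitution_Ioo) auto
    also have "\<dots> = (\<integral>\<^sup>+z. (\<Prod>c\<in>Basis. indicator {0<..} (z \<bullet> c) * indicator {a \<bullet> c<..<b \<bullet> c} (z \<bullet> c)) \<partial>lborel)"
      by (rule nn_integral_lborel_prod[symmetric]) auto
    also have "\<dots> = emeasure ?N (box a b)"
      by (simp add: N ind ind0 prod.distrib)
    finally show ?thesis .
  next
    case False
    then have "box a b = {}" by (force simp: box_eq_empty)
    then show ?thesis by simp
  qed
  have "?D = ?N"
  proof (rule measure_eqI_generator_eq)
    let ?E = "range (\<lambda>(a, b). box a b :: (real^'n) set)"
    show "Int_stable ?E"
      by (auto simp: Int_stable_def box_Int_box)
    show "?E \<subseteq> Pow UNIV" "sets ?D = sigma_sets UNIV ?E" "sets ?N = sigma_sets UNIV ?E"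
      by (simp_all add: borel_eq_box)
    let ?A = "\<lambda>n::nat. box (- (real n *\<^sub>R One)) (real n *\<^sub>R One) :: (real^'n) set"
    show "range ?A \<subseteq> ?E" "(\<Union>i. ?A i) = UNIV"
      unfolding UN_box_eq_UNIV by auto
    show "emeasure ?D X = emeasure ?N X" if "X \<in> ?E" for X using that box_eq by auto
    show "emeasure ?D (?A n) \<noteq> \<infinity>" for n
    proof -
      have "emeasure ?N (?A n) \<le> emeasure lborel (?A n)"
        by (subst N) (auto intro!: nn_integral_mono simp: indicator_def simp flip: nn_integral_indicator)
      also have "\<dots> < \<infinity>" by (rule emeasure_lborel_box_finite)
      finally show ?thesis using box_eq by simp
    qed
  qed
  then show ?thesis by simp
qed

lemma
  fixes F :: "real^'n::finite \<Rightarrow> 'b::{banach,second_countable_topology}"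
  assumes F: "(\<lambda>z. indicator pos_orthant z *\<^sub>R F z) \<in> borel_measurable borel"
  shows integrable_exp_substitution:
      "set_integrable lborel pos_orthant F \<longleftrightarrow>
         integrable lborel (\<lambda>x. (\<Prod>j\<in>UNIV. exp (x $ j)) *\<^sub>R F (exp_vec x))" (is ?int)
    and integral_exp_substitution:
      "(LINT z:pos_orthant|lborel. F z) =
         (LINT x|lborel. (\<Prod>j\<in>UNIV. exp (x $ j)) *\<^sub>R F (exp_vec x))" (is ?eq)
proof -
  define H where "H z = indicator pos_orthant z *\<^sub>R F z" for z
  have [measurable]: "H \<in> borel_measurable borel" using F by (simp add: H_def[abs_def])
  let ?N = "density lborel (\<lambda>z. ennreal (indicator (pos_orthant :: (real^'n) set) z))"
  let ?P = "density lborel (\<lambda>x::real^'n. ennreal (\<Prod>j\<in>UNIV. exp (x $ j)))"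
  have eq: "?N = distr ?P borel exp_vec" using pos_orthant_as_distr by (simp add: ennreal_indicator)
  have Hexp: "H (exp_vec x) = F (exp_vec x)" for x
    by (simp add: H_def pos_orthant_def exp_vec_def)
  have Hi: "indicator pos_orthant z *\<^sub>R H z = indicator pos_orthant z *\<^sub>R F z" for z
    by (simp add: H_def indicator_def)
  have [measurable]: "(\<lambda>x. F (exp_vec x)) \<in> borel_measurable borel"
    unfolding Hexp[symmetric] by measurable
  have "set_integrable lborel pos_orthant F \<longleftrightarrow> integrable ?N H"
    unfolding set_integrable_def by (subst integrable_density) (auto simp: Hi)
  also have "\<dots> \<longleftrightarrow> integrable ?P (\<lambda>x. H (exp_vec x))"
    unfolding eq by (rule integrable_distr_eq) auto
  also have "\<dots> \<longleftrightarrow> integrable lborel (\<lambda>x. (\<Prod>j\<in>UNIV. exp (x $ j)) *\<^sub>R F (exp_vec x))"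
    unfolding Hexp by (rule integrable_density) (auto intro!: prod_nonneg)
  finally show ?int .
  have "(LINT z:pos_orthant|lborel. F z) = integral\<^sup>L ?N H"
    unfolding set_lebesgue_integral_def by (subst integral_density) (auto simp: Hi)
  also have "\<dots> = (LINT x|?P. H (exp_vec x))"
    unfolding eq by (rule integral_distr) auto
  also have "\<dots> = (LINT x|lborel. (\<Prod>j\<in>UNIV. exp (x $ j)) *\<^sub>R F (exp_vec x))"
    unfolding Hexp by (rule integral_density) (auto intro!: prod_nonneg)
  finally show ?eq .
qed

section \<open>Estimates for the logarithms of the polynomials\<close>

lemma continuous_on_log_branch_exp_vec:
  fixes g :: "'n::finite cmpoly"
  assumes "log_branch g l"
  shows "continuous_on UNIV (\<lambda>x. l (exp_vec x))"
proof -
  have "continuous_on UNIV (exp_vec :: real^'n \<Rightarrow> real^'n)"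
    unfolding exp_vec_def by (intro continuous_intros)
  moreover have "continuous_on (range (exp_vec :: real^'n \<Rightarrow> real^'n)) l"
    using assms unfolding log_branch_def by (auto intro: continuous_on_subset)
  ultimately show ?thesis using continuous_on_compose[of UNIV exp_vec l] by (simp add: o_def)
qed

lemma exp_log_branch:
  "log_branch g l \<Longrightarrow> exp (l (exp_vec x)) = peval g (cvec (exp_vec x))"
  by (simp add: log_branch_def)

lemma exp_Re_log_branch:
  "log_branch g l \<Longrightarrow> exp (Re (l (exp_vec x))) = norm (peval g (cvec (exp_vec x)))"
  by (metis exp_log_branch norm_exp_eq_Re)

text \<open>
  Along the segment from \<open>0\<close> to \<open>x\<close> the polynomial is an exponential sum with as many terms as it
  has monomials. So the argument at \<open>x\<close> differs from the one at \<open>0\<close> by an amount that does not depend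
  on \<open>x\<close>.
\<close>

lemma log_branch_bounded_argument:
  fixes g :: "'n::finite cmpoly"
  assumes "log_branch g l"
  shows "\<exists>C. \<forall>x. \<bar>Im (l (exp_vec x))\<bar> \<le> C"
proof (intro exI allI)
  fix x :: "real^'n"
  let ?K = "Poly_Mapping.keys g"
  define \<phi> where "\<phi> u = Im (l (exp_vec (u *\<^sub>R x)))" for u
  have "\<bar>\<phi> 1 - \<phi> 0\<bar> \<le> real (card ?K + 2) * pi"
  proof (rule argument_variation_exponential_sum)
    show "continuous_on {0..1} \<phi>"
      unfolding \<phi>_def
      by (intro continuous_intros continuous_on_compose2[OF continuous_on_log_branch_exp_vec[OF assms]]) auto
    show "\<exists>r>0. (\<Sum>\<alpha>\<in>?K. Poly_Mapping.lookup g \<alpha> * of_real (exp ((real_exponent \<alpha> \<bullet> x) * u))) =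
        of_real r * cis (\<phi> u)" for u
    proof (intro exI conjI)
      let ?z = "l (exp_vec (u *\<^sub>R x))"
      have "(\<Sum>\<alpha>\<in>?K. Poly_Mapping.lookup g \<alpha> * of_real (exp ((real_exponent \<alpha> \<bullet> x) * u))) = exp ?z"
        unfolding exp_log_branch[OF assms] peval_exp_vec by (simp add: mult.commute del: of_real_exp)
      then show "(\<Sum>\<alpha>\<in>?K. Poly_Mapping.lookup g \<alpha> * of_real (exp ((real_exponent \<alpha> \<bullet> x) * u))) =
          of_real (exp (Re ?z)) * cis (\<phi> u)"
        by (simp only: exp_eq_polar[of ?z] \<phi>_def)
    qed simp
  qed simp
  then show "\<bar>Im (l (exp_vec x))\<bar> \<le> real (card ?K + 2) * pi + \<bar>Im (l (exp_vec 0))\<bar>"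
    by (simp add: \<phi>_def)
qed

text \<open>
  At the exponents this is the logarithm of \<open>completely_nonvanishing_lower_bound\<close>; both sides being
  affine in \<open>p\<close>, it extends to their convex hull.
\<close>

lemma Re_log_branch_lower_bound:
  fixes g :: "'n::finite cmpoly"
  assumes "completely_nonvanishing g (cvec ` pos_orthant)" "log_branch g l"
  shows "\<exists>C. \<forall>x. \<forall>p\<in>newton_polytope g. p \<bullet> x \<le> Re (l (exp_vec x)) + C"
proof -
  let ?K = "Poly_Mapping.keys g"
  obtain c where c: "c > 0" "\<And>x \<alpha>. \<alpha> \<in> ?K \<Longrightarrow>
      c * exp (real_exponent \<alpha> \<bullet> x) \<le> norm (peval g (cvec (exp_vec x)))"
    using completely_nonvanishing_lower_bound[OF assms(1)] by blast
  have vert: "real_exponent \<alpha> \<bullet> x \<le> Re (l (exp_vec x)) - ln c" if "\<alpha> \<in> ?K" for \<alpha> x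
  proof -
    have "exp (ln c + real_exponent \<alpha> \<bullet> x) \<le> exp (Re (l (exp_vec x)))"
      using c(2)[OF that, of x] \<open>c > 0\<close> by (simp add: exp_add exp_Re_log_branch[OF assms(2)])
    then show ?thesis by simp
  qed
  have "newton_polytope g \<subseteq> {p. x \<bullet> p \<le> Re (l (exp_vec x)) - ln c}" for x
    unfolding newton_polytope_def
  proof (rule hull_minimal)
    show "real_exponent ` ?K \<subseteq> {p. x \<bullet> p \<le> Re (l (exp_vec x)) - ln c}"
      using vert by (auto simp: inner_commute[of x])
  qed (rule convex_halfspace_le)
  then show ?thesis by (intro exI[of _ "- ln c"]) (auto simp: inner_commute)
qed

lemma log_branch_linear_growth:
  fixes g :: "'n::finite cmpoly"
  assumes "completely_nonvanishing g (cvec ` pos_orthant)" "log_branch g l"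
  shows "\<exists>B. \<forall>x. norm (l (exp_vec x)) \<le> B * (1 + norm x)"
proof -
  let ?K = "Poly_Mapping.keys g"
  have ne: "?K \<noteq> {}"
  proof
    assume "?K = {}"
    then have "peval g (cvec (exp_vec 0)) = 0" by (simp add: peval_def)
    then show False using exp_log_branch[OF assms(2)] by (metis exp_not_eq_zero)
  qed
  obtain A where A: "\<And>\<alpha>. \<alpha> \<in> ?K \<Longrightarrow> norm (real_exponent \<alpha>) \<le> A"
    using finite_imageI[OF finite_keys[of g], of real_exponent] finite_imp_bounded[of "real_exponent ` ?K"]
    unfolding bounded_iff by auto
  have "A \<ge> 0" using ne A norm_ge_zero order_trans by blast
  define D where "D = (\<Sum>\<alpha>\<in>?K. norm (Poly_Mapping.lookup g \<alpha>))"
  have "D > 0" unfolding D_def using ne by (intro sum_pos) (auto simp: in_keys_iff)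
  have upper: "Re (l (exp_vec x)) \<le> ln D + A * norm x" for x
  proof -
    have "norm (peval g (cvec (exp_vec x))) \<le>
        (\<Sum>\<alpha>\<in>?K. norm (Poly_Mapping.lookup g \<alpha> * of_real (exp (real_exponent \<alpha> \<bullet> x))))"
      unfolding peval_exp_vec by (rule norm_sum)
    also have "\<dots> \<le> (\<Sum>\<alpha>\<in>?K. norm (Poly_Mapping.lookup g \<alpha>) * exp (A * norm x))"
    proof (intro sum_mono)
      fix \<alpha> assume "\<alpha> \<in> ?K"
      have "real_exponent \<alpha> \<bullet> x \<le> norm (real_exponent \<alpha>) * norm x"
        by (rule norm_cauchy_schwarz)
      also have "\<dots> \<le> A * norm x" using A[OF \<open>\<alpha> \<in> ?K\<close>] by (intro mult_right_mono) auto
      finally show "norm (Poly_Mapping.lookup g \<alpha> * of_real (exp (real_exponent \<alpha> \<bullet> x)))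
          \<le> norm (Poly_Mapping.lookup g \<alpha>) * exp (A * norm x)"
        by (simp add: norm_mult mult_left_mono)
    qed
    also have "\<dots> = exp (ln D + A * norm x)"
      using \<open>D > 0\<close> by (simp add: exp_add D_def sum_distrib_right)
    finally have "exp (Re (l (exp_vec x))) \<le> exp (ln D + A * norm x)"
      by (simp add: exp_Re_log_branch[OF assms(2)])
    then show ?thesis by simp
  qed
  obtain C where C: "\<And>x p. p \<in> newton_polytope g \<Longrightarrow> p \<bullet> x \<le> Re (l (exp_vec x)) + C"
    using Re_log_branch_lower_bound[OF assms] by blast
  obtain \<alpha> where \<alpha>: "\<alpha> \<in> ?K" using ne by blast
  have lower: "- C - A * norm x \<le> Re (l (exp_vec x))" for x
  proof -
    have "real_exponent \<alpha> \<in> newton_polytope g" using \<alpha> by (simp add: newton_polytope_def hull_inc)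
    then have "real_exponent \<alpha> \<bullet> x - C \<le> Re (l (exp_vec x))" using C[of "real_exponent \<alpha>" x] by simp
    moreover have "\<bar>real_exponent \<alpha> \<bullet> x\<bar> \<le> norm (real_exponent \<alpha>) * norm x"
      by (rule Cauchy_Schwarz_ineq2)
    moreover have "norm (real_exponent \<alpha>) * norm x \<le> A * norm x"
      using A[OF \<alpha>] by (intro mult_right_mono) auto
    ultimately show ?thesis by linarith
  qed
  obtain C' where C': "\<And>x. \<bar>Im (l (exp_vec x))\<bar> \<le> C'" using log_branch_bounded_argument[OF assms(2)] by blast
  define B where "B = \<bar>ln D\<bar> + \<bar>C\<bar> + \<bar>C'\<bar> + A"
  have "norm (l (exp_vec x)) \<le> B * (1 + norm x)" for x
  proof -
    have "norm (l (exp_vec x)) \<le> \<bar>Re (l (exp_vec x))\<bar> + \<bar>Im (l (exp_vec x))\<bar>" by (rule cmod_le)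
    also have "\<dots> \<le> (\<bar>ln D\<bar> + \<bar>C\<bar> + \<bar>C'\<bar>) + A * norm x"
      using upper[of x] lower[of x] C'[of x] by linarith
    also have "\<dots> \<le> B + B * norm x"
    proof (rule add_mono)
      show "\<bar>ln D\<bar> + \<bar>C\<bar> + \<bar>C'\<bar> \<le> B" using \<open>A \<ge> 0\<close> by (simp add: B_def)
      show "A * norm x \<le> B * norm x" by (intro mult_right_mono) (auto simp: B_def)
    qed
    finally show ?thesis by (simp add: distrib_left)
  qed
  then show ?thesis by blast
qed

text \<open>
  The real part of the exponent of the integrand is the pairing of \<open>Re s\<close> with \<open>x\<close>, minus the sum of
  the \<open>Re t\<^sub>i * ln \<bar>f\<^sub>i\<bar>\<close>, plus terms \<open>Im t\<^sub>i * arg f\<^sub>i\<close> that stay bounded. Every \<open>q\<close> in the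
  weighted polytope satisfies \<open>q \<bullet> x \<le> (\<Sum>i. Re t\<^sub>i * ln \<bar>f\<^sub>i\<bar>) + const\<close>. Since \<open>Re s\<close> is an
  interior point, \<open>q\<close> may be taken as \<open>Re s\<close> moved by \<open>\<epsilon>\<close> in the direction of \<open>x\<close>, which gains the
  term \<open>\<epsilon> * norm x\<close>.
\<close>

lemma exponential_decay:
  fixes f :: "'m::finite \<Rightarrow> 'n::finite cmpoly" and s :: "complex^'n" and t :: "complex^'m"
  assumes cn: "\<And>i. completely_nonvanishing (f i) (cvec ` pos_orthant)"
    and lb: "\<And>i. log_branch (f i) (L i)"
    and pos: "re_vec t \<in> pos_orthant"
    and int: "re_vec s \<in> interior (weighted_newton_polytope f (re_vec t))"
  shows "\<exists>\<epsilon>>0. \<exists>C. \<forall>x. Re ((\<Sum>j\<in>UNIV. s $ j * of_real (x $ j)) - (\<Sum>i\<in>UNIV. t $ i * L i (exp_vec x)))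
           \<le> C - \<epsilon> * norm x"
proof -
  obtain \<epsilon> where \<epsilon>: "\<epsilon> > 0" "cball (re_vec s) \<epsilon> \<subseteq> weighted_newton_polytope f (re_vec t)"
    using int by (auto simp: mem_interior_cball)
  have "\<exists>C. \<forall>i x. \<forall>p\<in>newton_polytope (f i). p \<bullet> x \<le> Re (L i (exp_vec x)) + C i"
    using Re_log_branch_lower_bound[OF cn lb] by metis
  then obtain C where C: "\<And>i x p. p \<in> newton_polytope (f i) \<Longrightarrow> p \<bullet> x \<le> Re (L i (exp_vec x)) + C i"
    by blast
  have "\<exists>D. \<forall>i x. \<bar>Im (L i (exp_vec x))\<bar> \<le> D i"
    using log_branch_bounded_argument[OF lb] by metis
  then obtain D where D: "\<And>i x. \<bar>Im (L i (exp_vec x))\<bar> \<le> D i" by blast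
  have tpos: "Re (t $ i) > 0" for i using pos by (simp add: pos_orthant_def re_vec_def)
  have poly: "q \<bullet> x \<le> (\<Sum>i\<in>UNIV. Re (t $ i) * (Re (L i (exp_vec x)) + C i))"
    if q: "q \<in> weighted_newton_polytope f (re_vec t)" for q x
  proof -
    obtain y where y: "q = sum y UNIV" "\<And>i. y i \<in> (\<lambda>p. re_vec t $ i *\<^sub>R p) ` newton_polytope (f i)"
      using q unfolding weighted_newton_polytope_def set_sum_alt[OF finite] by auto
    have "y i \<bullet> x \<le> Re (t $ i) * (Re (L i (exp_vec x)) + C i)" for i
    proof -
      obtain p where "p \<in> newton_polytope (f i)" "y i = Re (t $ i) *\<^sub>R p"
        using y(2)[of i] by (auto simp: re_vec_def)
      then show ?thesis using C[of p i x] tpos[of i] by (simp add: mult_left_mono)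
    qed
    then show ?thesis unfolding y(1) inner_sum_left by (intro sum_mono) auto
  qed
  define C' where "C' = (\<Sum>i\<in>UNIV. Re (t $ i) * C i) + (\<Sum>i\<in>UNIV. \<bar>Im (t $ i)\<bar> * D i)"
  have "Re ((\<Sum>j\<in>UNIV. s $ j * of_real (x $ j)) - (\<Sum>i\<in>UNIV. t $ i * L i (exp_vec x))) \<le> C' - \<epsilon> * norm x"
    for x :: "real^'n"
  proof -
    have "re_vec s + \<epsilon> *\<^sub>R sgn x \<in> cball (re_vec s) \<epsilon>"
      using \<open>\<epsilon> > 0\<close> by (simp add: dist_norm norm_sgn)
    then have "(re_vec s + \<epsilon> *\<^sub>R sgn x) \<bullet> x \<le> (\<Sum>i\<in>UNIV. Re (t $ i) * (Re (L i (exp_vec x)) + C i))"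
      using \<epsilon>(2) poly by blast
    moreover have "sgn x \<bullet> x = norm x"
      by (cases "x = 0") (simp_all add: sgn_div_norm dot_square_norm power2_eq_square)
    moreover have "re_vec s \<bullet> x = (\<Sum>j\<in>UNIV. Re (s $ j) * x $ j)"
      by (simp add: inner_vec_def re_vec_def)
    moreover have "(\<Sum>i\<in>UNIV. Im (t $ i) * Im (L i (exp_vec x))) \<le> (\<Sum>i\<in>UNIV. \<bar>Im (t $ i)\<bar> * D i)"
    proof (intro sum_mono)
      fix i
      have "Im (t $ i) * Im (L i (exp_vec x)) \<le> \<bar>Im (t $ i)\<bar> * \<bar>Im (L i (exp_vec x))\<bar>"
        by (metis abs_ge_self abs_mult)
      also have "\<dots> \<le> \<bar>Im (t $ i)\<bar> * D i" using D by (intro mult_left_mono) auto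
      finally show "Im (t $ i) * Im (L i (exp_vec x)) \<le> \<bar>Im (t $ i)\<bar> * D i" .
    qed
    ultimately show ?thesis
      by (simp add: C'_def inner_add_left sum_subtractf sum.distrib distrib_left)
  qed
  then show ?thesis using \<open>\<epsilon> > 0\<close> by blast
qed

section \<open>The Euler-Mellin integral as a Laplace transform\<close>

text \<open>
  The vector of the functions that multiply the parameters \<open>s\<close> and \<open>t\<close> in the exponent of the
  integrand: coordinates of \<open>x\<close> in the first block, negative logarithms of the polynomials in the
  second.
\<close>

definition phase_vec ::
    "('m::finite \<Rightarrow> real ^ 'n::finite \<Rightarrow> complex) \<Rightarrow> real ^ 'n \<Rightarrow> complex ^ ('n + 'm)" where
  "phase_vec L x = (\<chi> k. case k of Inl j \<Rightarrow> of_real (x $ j) | Inr i \<Rightarrow> - L i (exp_vec x))"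

lemma sum_UNIV_Plus:
  fixes h :: "'n::finite + 'm::finite \<Rightarrow> 'b::comm_monoid_add"
  shows "(\<Sum>k\<in>UNIV. h k) = (\<Sum>j\<in>UNIV. h (Inl j)) + (\<Sum>i\<in>UNIV. h (Inr i))"
  by (subst UNIV_Plus_UNIV[symmetric], subst sum.Plus) auto

lemma pairing_phase_vec:
  "(\<Sum>k\<in>UNIV. w $ k * phase_vec L x $ k) =
     (\<Sum>j\<in>UNIV. s_part w $ j * of_real (x $ j)) - (\<Sum>i\<in>UNIV. t_part w $ i * L i (exp_vec x))"
  by (simp add: sum_UNIV_Plus phase_vec_def s_part_def t_part_def sum_negf)

lemma exp_integrand_eq_exp_pairing:
  "euler_mellin_exp_integrand L (s_part w) (t_part w) x = exp (\<Sum>k\<in>UNIV. w $ k * phase_vec L x $ k)"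
  unfolding pairing_phase_vec
  by (simp add: euler_mellin_exp_integrand_def branch_power_def exp_diff flip: exp_sum)

lemma integrand_exp_vec:
  "(\<Prod>j\<in>UNIV. exp (x $ j)) *\<^sub>R euler_mellin_integrand L s t (exp_vec x) = euler_mellin_exp_integrand L s t x"
proof -
  have "monomial_power (exp_vec x) s = exp (\<Sum>j\<in>UNIV. s $ j * of_real (x $ j))"
    unfolding monomial_power_def exp_vec_def
    by (simp add: powr_def exp_sum Ln_of_real flip: of_real_exp)
  moreover have "(\<Prod>j\<in>UNIV. exp (x $ j)) \<noteq> 0" by simp
  ultimately show ?thesis
    unfolding euler_mellin_integrand_def euler_mellin_exp_integrand_def
    by (simp add: exp_vec_def scaleR_conv_of_real del: of_real_prod of_real_exp)
qed

lemma measurable_phase_vec: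
  assumes "\<And>i. log_branch (f i) (L i)"
  shows "(\<lambda>x. phase_vec L x $ k) \<in> borel_measurable borel"
proof (cases k)
  case (Inl j)
  then show ?thesis by (simp add: phase_vec_def)
next
  case (Inr i)
  then show ?thesis
    using continuous_on_log_branch_exp_vec[OF assms[of i]]
    by (simp add: phase_vec_def borel_measurable_continuous_onI)
qed

text \<open>
  Replacing the branches by zero outside the orthant, where they are arbitrary, makes all factors
  measurable without changing the product with the indicator.
\<close>

lemma measurable_integrand:
  fixes L :: "'m::finite \<Rightarrow> real ^ 'n::finite \<Rightarrow> complex"
  assumes "\<And>i. log_branch (f i) (L i)"
  shows "(\<lambda>z. indicator pos_orthant z *\<^sub>R euler_mellin_integrand L s t z) \<in> borel_measurable borel"
proof -
  have L: "(\<lambda>z. indicator pos_orthant z *\<^sub>R L i z) \<in> borel_measurable borel" for i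
    using assms[of i] by (intro borel_measurable_continuous_on_indicator) (auto simp: log_branch_def)
  have eq: "indicator pos_orthant z *\<^sub>R euler_mellin_integrand L s t z =
     indicator pos_orthant z *\<^sub>R (exp (\<Sum>j\<in>UNIV. s $ j * of_real (ln (z $ j))) /
       exp (\<Sum>i\<in>UNIV. t $ i * (indicator pos_orthant z *\<^sub>R L i z)) / of_real (\<Prod>j\<in>UNIV. z $ j))" for z
  proof (cases "z \<in> pos_orthant")
    case True
    then have "z $ j > 0" for j by (simp add: pos_orthant_def)
    then have "monomial_power z s = exp (\<Sum>j\<in>UNIV. s $ j * of_real (ln (z $ j)))"
      unfolding monomial_power_def by (simp add: powr_def exp_sum Ln_of_real less_imp_neq[symmetric])
    with True show ?thesis
      by (simp add: euler_mellin_integrand_def branch_power_def exp_sum)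
  qed simp
  show ?thesis unfolding eq using L by measurable
qed

lemma phase_vec_linear_growth:
  fixes f :: "'m::finite \<Rightarrow> 'n::finite cmpoly"
  assumes "\<And>i. completely_nonvanishing (f i) (cvec ` pos_orthant)"
    and "\<And>i. log_branch (f i) (L i)"
  shows "\<exists>B>0. \<forall>x. (\<Sum>k\<in>UNIV. norm (phase_vec L x $ k)) \<le> B * (1 + norm x)"
proof -
  have "\<exists>B. \<forall>i x. norm (L i (exp_vec x)) \<le> B i * (1 + norm x)"
    using log_branch_linear_growth[OF assms] by metis
  then obtain B where B: "\<And>i x. norm (L i (exp_vec x)) \<le> B i * (1 + norm x)" by blast
  define B' where "B' = real CARD('n) + (\<Sum>i\<in>UNIV. \<bar>B i\<bar>)"
  have "(\<Sum>k\<in>UNIV. norm (phase_vec L x $ k)) \<le> B' * (1 + norm x)" for x :: "real^'n"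
  proof -
    have "(\<Sum>j\<in>UNIV. \<bar>x $ j\<bar>) \<le> (\<Sum>j\<in>(UNIV::'n set). 1 + norm x)"
    proof (intro sum_mono)
      fix j show "\<bar>x $ j\<bar> \<le> 1 + norm x" using component_le_norm_cart[of x j] by linarith
    qed
    moreover have "(\<Sum>i\<in>UNIV. norm (L i (exp_vec x))) \<le> (\<Sum>i\<in>UNIV. \<bar>B i\<bar> * (1 + norm x))"
    proof (intro sum_mono)
      fix i
      have "B i * (1 + norm x) \<le> \<bar>B i\<bar> * (1 + norm x)" by (intro mult_right_mono) auto
      then show "norm (L i (exp_vec x)) \<le> \<bar>B i\<bar> * (1 + norm x)" using B[of i x] by linarith
    qed
    ultimately show ?thesis
      by (simp add: sum_UNIV_Plus phase_vec_def B'_def distrib_right sum_distrib_right)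
  qed
  moreover have "B' > 0" unfolding B'_def by (simp add: add_pos_nonneg sum_nonneg)
  ultimately show ?thesis by blast
qed

text \<open>
  The extra factor grows at most like \<open>exp (r * B * norm x)\<close>; for small \<open>r\<close> the exponential decay of
  the integrand still wins.
\<close>

lemma dominated_integrand:
  fixes f :: "'m::finite \<Rightarrow> 'n::finite cmpoly"
  assumes cn: "\<And>i. completely_nonvanishing (f i) (cvec ` pos_orthant)"
    and lb: "\<And>i. log_branch (f i) (L i)"
    and w: "w \<in> tube_domain f"
  shows "\<exists>r>0. integrable lborel (\<lambda>x. norm (exp (\<Sum>k\<in>UNIV. w $ k * phase_vec L x $ k)) *
           exp (r * (\<Sum>k\<in>UNIV. norm (phase_vec L x $ k))))"
proof -
  obtain \<epsilon> C where \<epsilon>: "\<epsilon> > 0" and decay: "\<And>x. Re (\<Sum>k\<in>UNIV. w $ k * phase_vec L x $ k) \<le> C - \<epsilon> * norm x"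
    using exponential_decay[where f = f and L = L and t = "t_part w" and s = "s_part w", OF cn lb] w
    unfolding tube_domain_def pairing_phase_vec by blast
  obtain B where B: "B > 0" "\<And>x. (\<Sum>k\<in>UNIV. norm (phase_vec L x $ k)) \<le> B * (1 + norm x)"
    using phase_vec_linear_growth[where f = f and L = L, OF cn lb] by blast
  \<comment> \<open>With this radius half of the decay rate is left over.\<close>
  define r where "r = \<epsilon> / (2 * B)"
  have "r > 0" using \<epsilon> B by (simp add: r_def)
  note [measurable] = measurable_phase_vec[where f = f and L = L, OF lb]
  have "integrable lborel (\<lambda>x::real^'n. exp (C + \<epsilon> / 2) * exp (- (\<epsilon> / 2) * norm x))"
    using integrable_exp_minus_norm[of "\<epsilon> / 2"] \<epsilon> by (intro integrable_mult_right) auto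
  then have "integrable lborel (\<lambda>x. norm (exp (\<Sum>k\<in>UNIV. w $ k * phase_vec L x $ k)) *
           exp (r * (\<Sum>k\<in>UNIV. norm (phase_vec L x $ k))))"
  proof (rule Bochner_Integration.integrable_bound)
    show "AE x in lborel. norm (norm (exp (\<Sum>k\<in>UNIV. w $ k * phase_vec L x $ k)) *
           exp (r * (\<Sum>k\<in>UNIV. norm (phase_vec L x $ k)))) \<le> norm (exp (C + \<epsilon> / 2) * exp (- (\<epsilon> / 2) * norm x))"
    proof (intro always_eventually allI)
      fix x
      have "r * (\<Sum>k\<in>UNIV. norm (phase_vec L x $ k)) \<le> r * (B * (1 + norm x))"
        using B(2) \<open>r > 0\<close> by (intro mult_left_mono) auto
      also have "\<dots> = \<epsilon> / 2 + \<epsilon> / 2 * norm x" using B(1) by (simp add: r_def field_simps)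
      finally have "Re (\<Sum>k\<in>UNIV. w $ k * phase_vec L x $ k) + r * (\<Sum>k\<in>UNIV. norm (phase_vec L x $ k))
          \<le> (C + \<epsilon> / 2) + - (\<epsilon> / 2) * norm x"
        using decay[of x] by simp
      then show "norm (norm (exp (\<Sum>k\<in>UNIV. w $ k * phase_vec L x $ k)) *
           exp (r * (\<Sum>k\<in>UNIV. norm (phase_vec L x $ k)))) \<le> norm (exp (C + \<epsilon> / 2) * exp (- (\<epsilon> / 2) * norm x))"
        by (simp only: norm_exp_eq_Re real_norm_def abs_mult abs_exp_cancel flip: exp_add) simp
    qed
  qed simp
  with \<open>r > 0\<close> show ?thesis by blast
qed

theorem theorem2p2:
  fixes f :: "'m::finite \<Rightarrow> 'n::finite cmpoly"
    and L :: "'m \<Rightarrow> real ^ 'n \<Rightarrow> complex"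
  assumes "\<And>i. completely_nonvanishing (f i) (cvec ` pos_orthant)"
    and "\<And>i. log_branch (f i) (L i)"
  shows "(\<forall>w \<in> tube_domain f.
            set_integrable lborel pos_orthant (euler_mellin_integrand L (s_part w) (t_part w)) \<and>
            integrable lborel (euler_mellin_exp_integrand L (s_part w) (t_part w)) \<and>
            euler_mellin L (s_part w) (t_part w) =
              (LINT x|lborel. euler_mellin_exp_integrand L (s_part w) (t_part w) x)) \<and>
         mv_analytic_on (\<lambda>w. euler_mellin L (s_part w) (t_part w)) (tube_domain f)"
proof -
  note substitution =
    integrable_exp_substitution[OF measurable_integrand[where f = f and L = L, OF assms(2)], unfolded integrand_exp_vec]
    integral_exp_substitution[OF measurable_integrand[where f = f and L = L, OF assms(2)], unfolded integrand_exp_vec]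
  have integral_eq: "euler_mellin L (s_part w) (t_part w) =
      (LINT x|lborel. euler_mellin_exp_integrand L (s_part w) (t_part w) x)" for w
    unfolding euler_mellin_def by (rule substitution)
  note [measurable] = measurable_phase_vec[where f = f and L = L, OF assms(2)]
  have integrable: "integrable lborel (euler_mellin_exp_integrand L (s_part w) (t_part w))"
    if w: "w \<in> tube_domain f" for w
  proof -
    obtain r where r: "r > 0" and int: "integrable lborel (\<lambda>x. norm (exp (\<Sum>k\<in>UNIV. w $ k * phase_vec L x $ k)) *
        exp (r * (\<Sum>k\<in>UNIV. norm (phase_vec L x $ k))))"
      using dominated_integrand[where f = f and L = L, OF assms w] by blast
    have "integrable lborel (\<lambda>x. exp (\<Sum>k\<in>UNIV. w $ k * phase_vec L x $ k))"
    proof (rule Bochner_Integration.integrable_bound[OF int])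
      have "0 \<le> r * (\<Sum>k\<in>UNIV. norm (phase_vec L x $ k))" for x
        using r by (intro mult_nonneg_nonneg sum_nonneg) auto
      then show "AE x in lborel. norm (exp (\<Sum>k\<in>UNIV. w $ k * phase_vec L x $ k)) \<le>
        norm (norm (exp (\<Sum>k\<in>UNIV. w $ k * phase_vec L x $ k)) * exp (r * (\<Sum>k\<in>UNIV. norm (phase_vec L x $ k))))"
        by (intro always_eventually allI) (simp add: abs_mult)
    qed simp
    then show ?thesis by (simp add: exp_integrand_eq_exp_pairing[abs_def])
  qed
  have "mv_analytic_on (\<lambda>w. euler_mellin L (s_part w) (t_part w)) (tube_domain f)"
    unfolding mv_analytic_on_def
  proof
    fix a assume a: "a \<in> tube_domain f"
    obtain r where r: "r > 0" "integrable lborel (\<lambda>x. norm (exp (\<Sum>k\<in>UNIV. a $ k * phase_vec L x $ k)) *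
        exp (r * (\<Sum>k\<in>UNIV. norm (phase_vec L x $ k))))"
      using dominated_integrand[where f = f and L = L, OF assms a] by blast
    show "\<exists>r>0. \<exists>c. \<forall>w. (\<forall>j. norm (w $ j - a $ j) < r) \<longrightarrow>
          ((\<lambda>\<alpha>. c \<alpha> * (\<Prod>j\<in>UNIV. (w $ j - a $ j) ^ (\<alpha> $ j))) has_sum euler_mellin L (s_part w) (t_part w)) UNIV"
      unfolding integral_eq exp_integrand_eq_exp_pairing
      using r by (intro exI[of _ r] conjI laplace_transform_power_series) auto
  qed
  then show ?thesis using integrable substitution(1) integral_eq by blast
qed

end
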